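(* Let $\Omega$ be a countably infinite set, and let $f, g, h \in \mathrm{Inj}(\Omega) \setminus \mathrm{Sym}(\Omega)$ be any three maps. Then there exist permutations $a, b \in \mathrm{Sym}(\Omega)$ such that $h = afa^{-1}bgb^{-1}$ if and only if $|\Omega \setminus (\Omega)f| + |\Omega \setminus (\Omega)g| = |\Omega \setminus (\Omega)h|$.
   Context: $\mathrm{Inj}(\Omega)$ is the monoid of all injective maps $\Omega \to \Omega$, and $\mathrm{Sym}(\Omega)$ is the group of all permutations of $\Omega$. Maps are written on the right of their arguments, so $(\alpha)fg = ((\alpha)f)g$, and $(\Omega)f$ denotes the image of $f$. $|\cdot|$ denotes cardinality, and sums are sums of cardinals. *)

theory Defs
  imports "HOL-Algebra.Bij" "HOL-Library.Countable_Set"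
begin

unbundle cardinal_syntax

text \<open>
  Maps on a set are extensional functions (as in \<^const>\<open>Bij\<close>), so that equality of maps is
  equality on the set. Maps act on the right, so the product of \<open>f\<close> and \<open>g\<close> applies \<open>f\<close> first;
  this is the opposite of the convention of \<^const>\<open>BijGroup\<close>.
\<close>

definition Inj :: "'a set \<Rightarrow> ('a \<Rightarrow> 'a) monoid" where
  "Inj \<Omega> =
    \<lparr>carrier = {f \<in> \<Omega> \<rightarrow>\<^sub>E \<Omega>. inj_on f \<Omega>},
     mult = \<lambda>f g. compose \<Omega> g f,
     one = \<lambda>x\<in>\<Omega>. x\<rparr>"

abbreviation Sym :: "'a set \<Rightarrow> ('a \<Rightarrow> 'a) set" where
  "Sym \<Omega> \<equiv> Bij \<Omega>"

lemma monoid_Inj: "monoid (Inj \<Omega>)"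
proof (rule monoidI)
  fix f g assume "f \<in> carrier (Inj \<Omega>)" "g \<in> carrier (Inj \<Omega>)"
  then have f: "f \<in> \<Omega> \<rightarrow> \<Omega>" "inj_on f \<Omega>" and g: "g \<in> \<Omega> \<rightarrow> \<Omega>" "inj_on g \<Omega>"
    by (auto simp: Inj_def PiE_def)
  have "inj_on (compose \<Omega> g f) \<Omega>"
  proof (rule inj_onI)
    fix x y assume "x \<in> \<Omega>" "y \<in> \<Omega>" "compose \<Omega> g f x = compose \<Omega> g f y"
    then have "f x = f y"
      using f(1) by (metis g(2) compose_eq funcset_mem inj_onD)
    with \<open>x \<in> \<Omega>\<close> \<open>y \<in> \<Omega>\<close> show "x = y"
      using f(2) by (metis inj_onD)
  qed
  moreover have "compose \<Omega> g f \<in> \<Omega> \<rightarrow> \<Omega>"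
    using f(1) g(1) by (rule funcset_compose)
  ultimately show "f \<otimes>\<^bsub>Inj \<Omega>\<^esub> g \<in> carrier (Inj \<Omega>)"
    by (simp add: Inj_def PiE_def)
next
  fix f g k assume "f \<in> carrier (Inj \<Omega>)" "g \<in> carrier (Inj \<Omega>)" "k \<in> carrier (Inj \<Omega>)"
  then show "f \<otimes>\<^bsub>Inj \<Omega>\<^esub> g \<otimes>\<^bsub>Inj \<Omega>\<^esub> k = f \<otimes>\<^bsub>Inj \<Omega>\<^esub> (g \<otimes>\<^bsub>Inj \<Omega>\<^esub> k)"
    by (simp add: Inj_def PiE_def compose_assoc[of f \<Omega> \<Omega>, symmetric])
next
  show "\<one>\<^bsub>Inj \<Omega>\<^esub> \<in> carrier (Inj \<Omega>)"
    by (simp add: Inj_def inj_on_def)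
next
  fix f assume "f \<in> carrier (Inj \<Omega>)"
  then have "f \<in> \<Omega> \<rightarrow> \<Omega>" "f \<in> extensional \<Omega>"
    by (auto simp: Inj_def PiE_def)
  then show "\<one>\<^bsub>Inj \<Omega>\<^esub> \<otimes>\<^bsub>Inj \<Omega>\<^esub> f = f" "f \<otimes>\<^bsub>Inj \<Omega>\<^esub> \<one>\<^bsub>Inj \<Omega>\<^esub> = f"
    by (simp_all add: Inj_def)
qed

lemma Sym_subset_Inj: "Sym \<Omega> \<subseteq> carrier (Inj \<Omega>)"
  by (auto simp: Bij_def Inj_def bij_betw_def PiE_iff)

lemma Sym_inverse:
  assumes "a \<in> Sym \<Omega>"
  defines "a' \<equiv> restrict (inv_into \<Omega> a) \<Omega>"
  shows "a' \<in> Sym \<Omega>" "a \<otimes>\<^bsub>Inj \<Omega>\<^esub> a' = \<one>\<^bsub>Inj \<Omega>\<^esub>" "a' \<otimes>\<^bsub>Inj \<Omega>\<^esub> a = \<one>\<^bsub>Inj \<Omega>\<^esub>"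
proof -
  show "a' \<in> Sym \<Omega>"
    unfolding a'_def using assms(1) by (rule restrict_inv_into_Bij)
  show "a \<otimes>\<^bsub>Inj \<Omega>\<^esub> a' = \<one>\<^bsub>Inj \<Omega>\<^esub>"
    using Bij_compose_restrict_eq[OF assms(1)] by (simp add: Inj_def a'_def)
  show "a' \<otimes>\<^bsub>Inj \<Omega>\<^esub> a = \<one>\<^bsub>Inj \<Omega>\<^esub>"
  proof -
    have "a (inv_into \<Omega> a x) = x" if "x \<in> \<Omega>" for x
      using assms(1) that by (simp add: Bij_def bij_betw_def f_inv_into_f)
    then show ?thesis
      by (simp add: Inj_def a'_def compose_def cong: restrict_cong)
  qed
qed

lemma inv_Sym: "a \<in> Sym \<Omega> \<Longrightarrow> inv\<^bsub>Inj \<Omega>\<^esub> a = restrict (inv_into \<Omega> a) \<Omega>"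
  by (rule monoid.inv_unique'[OF monoid_Inj, symmetric])
     (auto intro: Sym_inverse subsetD[OF Sym_subset_Inj])

lemma Units_Inj: "Units (Inj \<Omega>) = Sym \<Omega>"
proof
  show "Sym \<Omega> \<subseteq> Units (Inj \<Omega>)"
    using Sym_inverse Sym_subset_Inj unfolding Units_def by blast
  show "Units (Inj \<Omega>) \<subseteq> Sym \<Omega>"
  proof
    fix f assume "f \<in> Units (Inj \<Omega>)"
    then obtain g where f: "f \<in> carrier (Inj \<Omega>)" and g: "g \<in> carrier (Inj \<Omega>)"
      and "g \<otimes>\<^bsub>Inj \<Omega>\<^esub> f = \<one>\<^bsub>Inj \<Omega>\<^esub>"
      by (auto simp: Units_def)
    then have "compose \<Omega> f g = (\<lambda>x\<in>\<Omega>. x)"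
      by (simp add: Inj_def)
    then have fg: "f (g x) = x" if "x \<in> \<Omega>" for x
      using that by (metis compose_eq restrict_apply')
    have "\<Omega> \<subseteq> f ` \<Omega>"
    proof
      fix x assume "x \<in> \<Omega>"
      moreover have "g x \<in> \<Omega>"
        using g \<open>x \<in> \<Omega>\<close> by (auto simp: Inj_def)
      ultimately show "x \<in> f ` \<Omega>"
        using fg[of x] by (metis imageI)
    qed
    then show "f \<in> Sym \<Omega>"
      using f by (auto simp: Inj_def Bij_def bij_betw_def PiE_iff)
  qed
qed

end

theory Submission
  imports Defs
begin

text \<open>
  The defect of an injection is the number of points outside of its image. Defects are
  invariant under conjugation and add up in products (\<open>defect_add\<close>), which is one half of the
  theorem. The other half asks for a vertex set with three injections \<open>F\<close>, \<open>G\<close> and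
  \<open>H\<close>, where \<open>H\<close> applies first \<open>F\<close> and then \<open>G\<close>, that are conjugate to \<open>f\<close>, \<open>g\<close> and \<open>h\<close>.

  Putting an infinite backward chain in front of every point outside of the image completes an
  injection to a permutation. If the defects add up, the chains of \<open>h\<close> can be indexed by those
  of \<open>f\<close> and \<open>g\<close> together, and on the added points the relation between the three maps holds
  from the start (\<open>prolong_coherent\<close>). With \<open>k = h\<^sup>-\<^sup>1\<close>, the task becomes to extend this to
  permutations with \<open>KGF = 1\<close>, a condition that is symmetric under rotation and reversal.

  A vertex carries three labels, one in the domain of each of \<open>f\<close>, \<open>g\<close> and \<open>k\<close>. At each
  stage only finitely many vertices have been added, and the labels determine
  edges; the stage is coherent if two edges of a triangle imply the third. A careless
  back-and-forth fails: assigning a label between two used ones can force labels of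
  other coordinates from two sides in conflicting ways. This is prevented by keeping the set of
  used labels convex in each orbit, so that every forced label has one neighbour only
  (\<open>add_successor\<close>). Convexity demands unused infinite orbits again and again, while \<open>f\<close> may
  have a single infinite orbit. The additional orbits are therefore provisional reserve chains.
  A reserve chain becomes permanent when it is spliced behind the used part of a
  main chain (\<open>join_chains\<close>): the forward half of an infinite orbit, leaving the added points
  for good, which exists because the map is not surjective. Every label gets assigned (\<open>assign_label\<close>), every vertex gets
  permanent labels (\<open>make_permanent\<close>), and the permanent labels converge to the conjugating
  bijections (\<open>coherent_completion\<close>).
\<close>

section \<open>Orbit-convex sets\<close>

text \<open>
  The name \<open>inv\<close> denotes inversion in a monoid here, so the inverse of a map needs its own.
\<close>

abbreviation invf :: "('s \<Rightarrow> 's) \<Rightarrow> 's \<Rightarrow> 's" where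
  "invf f \<equiv> inv_into UNIV f"

text \<open>
  A set is orbit-convex if it meets every orbit in an interval; it contains a finite orbit as
  soon as it meets it. A point next to such an interval, but outside of it, has only one
  neighbour in the set. This keeps a new label from being forced from two sides.
\<close>

definition orbit_convex :: "('s \<Rightarrow> 's) \<Rightarrow> 's set \<Rightarrow> bool" where
  "orbit_convex f A \<longleftrightarrow> (\<forall>s\<in>A. \<forall>n. (f ^^ n) s \<in> A \<longrightarrow> (\<forall>m\<le>n. (f ^^ m) s \<in> A))"

lemma inv_funpow_cancel:
  assumes "bij f" shows "(f ^^ n) ((invf f ^^ n) s) = s"
proof (induction n arbitrary: s)
  case (Suc n)
  have "(f ^^ Suc n) ((invf f ^^ Suc n) s) = f ((f ^^ n) ((invf f ^^ n) (invf f s)))"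
    by (simp add: funpow_swap1)
  then show ?case using Suc assms by (simp add: bij_is_surj surj_f_inv_f)
qed simp

lemma orbit_convex_inv_imp:
  assumes f: "bij f" and A: "orbit_convex f A"
  shows "orbit_convex (invf f) A"
  unfolding orbit_convex_def
proof (intro ballI allI impI)
  fix s n m assume "s \<in> A" and n: "(invf f ^^ n) s \<in> A" and "m \<le> n"
  have "(invf f ^^ n) s = (invf f ^^ (n - m)) ((invf f ^^ m) s)"
    using \<open>m \<le> n\<close> funpow_add[of "n - m" m "invf f"] by simp
  then have "(f ^^ (n - m)) ((invf f ^^ n) s) = (invf f ^^ m) s"
    using inv_funpow_cancel[OF f] by simp
  moreover have "(f ^^ (n - m)) ((invf f ^^ n) s) \<in> A"
    using A n \<open>s \<in> A\<close> inv_funpow_cancel[OF f, of n s] unfolding orbit_convex_def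
    by (metis diff_le_self)
  ultimately show "(invf f ^^ m) s \<in> A" by simp
qed

lemma orbit_convex_gap:
  assumes "orbit_convex f A" "s \<in> A" "f (f s) \<in> A" shows "f s \<in> A"
  using assms(1)[unfolded orbit_convex_def, rule_format, of s 2 1] assms(2,3)
  by (simp add: numeral_2_eq_2)

text \<open>
  A segment that ends in \<open>f s\<close> passes through \<open>s\<close> before, and has no hole up to there. A
  segment that starts in \<open>f s\<close> cannot return to \<open>A\<close>: prolonged by \<open>s\<close>, it would put \<open>f s\<close> into \<open>A\<close>.
\<close>

lemma orbit_convex_insert_succ:
  assumes f: "bij f" and A: "orbit_convex f A" and s: "s \<in> A"
  shows "orbit_convex f (insert (f s) A)"
proof (cases "f s \<in> A")
  case False
  have pre: "t = s" if "f t = f s" for t using that bij_is_inj[OF f] by (simp add: inj_eq)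
  show ?thesis unfolding orbit_convex_def
  proof (intro ballI allI impI)
    fix t n m assume t: "t \<in> insert (f s) A" and n: "(f ^^ n) t \<in> insert (f s) A" and m: "m \<le> n"
    have from_s: "(f ^^ n) (f s) \<notin> A" for n
    proof
      assume "(f ^^ n) (f s) \<in> A"
      then have "(f ^^ Suc n) s \<in> A" by (simp add: funpow_swap1)
      then have "(f ^^ 1) s \<in> A"
        using A[unfolded orbit_convex_def, rule_format, OF s, of "Suc n" 1] by simp
      with False show False by simp
    qed
    have no_return: "(f ^^ n) (f s) \<noteq> f s" if "n > 0" for n
    proof
      obtain n' where n': "n = Suc n'" using \<open>n > 0\<close> by (cases n) auto
      assume "(f ^^ n) (f s) = f s"
      then have "(f ^^ n') (f s) = s" using n' pre by simp
      with from_s[of n'] s show False by simp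
    qed
    show "(f ^^ m) t \<in> insert (f s) A"
    proof (cases "t = f s")
      case True
      then have "n = 0" using n from_s no_return by auto
      then show ?thesis using t m by simp
    next
      case tA: False
      with t have "t \<in> A" by simp
      show ?thesis
      proof (cases "m = n")
        case True then show ?thesis using n by simp
      next
        case False
        then obtain n' where n': "n = Suc n'" "m \<le> n'" using m by (cases n) auto
        have "(f ^^ n) t \<in> A \<or> (f ^^ n') t \<in> A" using n n' pre s by auto
        then show ?thesis using A \<open>t \<in> A\<close> n' m unfolding orbit_convex_def by blast
      qed
    qed
  qed
qed (use A in \<open>simp add: insert_absorb\<close>)

lemma orbit_convex_Un:
  assumes "orbit_convex f A" "orbit_convex f C"
    and "\<And>a n. a \<in> A \<Longrightarrow> (f ^^ n) a \<notin> C" and "\<And>c n. c \<in> C \<Longrightarrow> (f ^^ n) c \<notin> A"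
  shows "orbit_convex f (A \<union> C)"
  using assms unfolding orbit_convex_def by blast

section \<open>Permanent and provisional labels\<close>

text \<open>
  A label \<open>Inl x\<close> is permanent. A label \<open>Inr (j, i)\<close> is provisional: it is the point \<open>i\<close> of the
  reserve chain \<open>j\<close>. The reserve supplies infinitely many unused infinite orbits, although the
  given maps may have only one, so that a label without any neighbour is always at hand.
\<close>

type_synonym 'p label = "'p + nat \<times> int"

definition lift :: "int \<Rightarrow> ('p \<Rightarrow> 'p) \<Rightarrow> 'p label \<Rightarrow> 'p label" where
  "lift e f = map_sum f (\<lambda>(j, i). (j, i + e))"

lemma lift_simps [simp]:
  "lift e f (Inl x) = Inl (f x)" "lift e f (Inr (j, i)) = Inr (j, i + e)"
  by (simp_all add: lift_def)

lemma lift_funpow [simp]: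
  "(lift e f ^^ n) (Inl x) = Inl ((f ^^ n) x)"
  "(lift e f ^^ n) (Inr (j, i)) = Inr (j, i + int n * e)"
  by (induction n) (auto simp: algebra_simps)

lemma bij_lift: assumes "bij f" shows "bij (lift e f)"
  and inv_lift: "invf (lift e f) = lift (- e) (invf f)"
proof -
  have 1: "lift e f (lift (- e) (invf f) s) = s" for s
    using assms by (cases s) (auto simp: bij_is_surj surj_f_inv_f)
  have 2: "lift (- e) (invf f) (lift e f s) = s" for s
    using assms by (cases s) (auto simp: bij_is_inj)
  show "bij (lift e f)" using 1 2 by (intro o_bij[of "lift (- e) (invf f)"]) (auto simp: fun_eq_iff)
  show "invf (lift e f) = lift (- e) (invf f)" using 1 2 by (intro inv_equality)
qed

text \<open>
  The inverse of a lift shifts the reserve chains the other way; admitting both directions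
  makes the notion stable under inversion.
\<close>

definition lifted :: "('p label \<Rightarrow> 'p label) \<Rightarrow> bool" where
  "lifted f \<longleftrightarrow> (\<exists>e f0. (e = 1 \<or> e = -1) \<and> bij f0 \<and> f = lift e f0)"

lemma lifted_bij: "lifted f \<Longrightarrow> bij f"
  by (auto simp: lifted_def bij_lift)

lemma lifted_inv: "lifted f \<Longrightarrow> lifted (invf f)"
  unfolding lifted_def
  by (elim exE conjE, rule_tac x = "- e" in exI, rule_tac x = "invf f0" in exI)
     (auto simp: inv_lift bij_imp_bij_inv)

text \<open>
  The set \<open>B\<close> holds the points that are labelled from the start. At each stage only finitely
  many labels have been added to them, which leaves room in the reserve and in every infinite
  orbit that escapes from \<open>B\<close>.
\<close>

definition labelling ::
  "'p set \<Rightarrow> ('p label \<Rightarrow> 'p label) \<Rightarrow> 'v set \<Rightarrow> ('v \<Rightarrow> 'p label) \<Rightarrow> bool" where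
  "labelling B f X l \<longleftrightarrow> lifted f \<and> inj_on l X \<and> orbit_convex f (l ` X)
     \<and> Inl ` B \<subseteq> l ` X \<and> finite (l ` X - Inl ` B)"

lemma labelling_inv: "labelling B f X l \<Longrightarrow> labelling B (invf f) X l"
  by (auto simp: labelling_def lifted_inv lifted_bij orbit_convex_inv_imp)

lemma labelling_insert:
  assumes "labelling B f X l" "w \<notin> X" "s \<notin> l ` X" "orbit_convex f (insert s (l ` X))"
  shows "labelling B f (insert w X) (l(w := s))"
proof -
  have "(l(w := s)) ` insert w X = insert s (l ` X)" using assms(2) by auto
  moreover have "inj_on (l(w := s)) (insert w X)"
    using assms by (auto simp: labelling_def inj_on_def)
  ultimately show ?thesis using assms unfolding labelling_def
    by (auto simp: insert_Diff_if)
qed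

text \<open>
  The finitely many labels outside of \<open>Inl ` B\<close> touch only finitely many reserve chains. The
  point \<open>0\<close> of each of several other chains is isolated from all labels in use.
\<close>

lemma fresh_labels:
  assumes l: "labelling B f X l" and W: "finite W"
  obtains t where "inj_on t W" "t ` W \<inter> l ` X = {}" "orbit_convex f (l ` X \<union> t ` W)"
    "\<And>w s. w \<in> W \<Longrightarrow> s \<in> l ` X \<union> t ` W \<Longrightarrow> t w \<noteq> f s \<and> s \<noteq> f (t w)"
proof -
  obtain e f0 where e: "e = 1 \<or> e = -1" and f: "f = lift e f0" and bij: "bij f"
    using l unfolding labelling_def lifted_def by (metis bij_lift)
  define U where "U = {j. \<exists>i. Inr (j, i) \<in> l ` X}"
  have "U \<subseteq> (\<lambda>s. fst (projr s)) ` (l ` X - Inl ` B)"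
  proof
    fix j assume "j \<in> U"
    then obtain i where "Inr (j, i) \<in> l ` X - Inl ` B" by (auto simp: U_def)
    then show "j \<in> (\<lambda>s. fst (projr s)) ` (l ` X - Inl ` B)" by (rule rev_image_eqI) simp
  qed
  then have "finite U" using l unfolding labelling_def by (meson finite_imageI finite_subset)
  then have "infinite (- U)" by (simp add: finite_compl)
  then obtain T where T: "T \<subseteq> - U" "finite T" "card T = card W"
    using infinite_arbitrarily_large by blast
  then obtain c where c: "bij_betw c W T" using W finite_same_card_bij by metis
  define t where "t = (\<lambda>w. Inr (c w, 0) :: 'a label)"
  have cU: "c w \<notin> U" if "w \<in> W" for w using that c T bij_betwE by blast
  have inj: "c w = c w' \<longleftrightarrow> w = w'" if "w \<in> W" "w' \<in> W" for w w'
    using that c by (auto simp: bij_betw_def inj_on_def)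
  have away: "(f ^^ n) a \<notin> t ` W" if "a \<in> l ` X" for a n
  proof (cases a)
    case (Inr x)
    obtain j i where x: "x = (j, i)" by (cases x)
    then have "j \<in> U" using that Inr by (auto simp: U_def)
    then show ?thesis using cU Inr x by (auto simp: t_def f)
  qed (auto simp: f t_def)
  have away': "(f ^^ n) a \<notin> l ` X" if a: "a \<in> t ` W" for a n
  proof -
    obtain w where w: "w \<in> W" "a = Inr (c w, 0)" using a by (auto simp: t_def)
    then have "Inr (c w, int n * e) \<notin> l ` X" using cU by (auto simp: U_def)
    then show ?thesis using w by (simp add: f)
  qed
  show ?thesis
  proof
    show "inj_on t W" using inj by (auto simp: inj_on_def t_def)
    show "t ` W \<inter> l ` X = {}" using away'[of _ 0] by fastforce
    have "orbit_convex f (t ` W)"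
      using e inj by (auto simp: orbit_convex_def f t_def)
    then show "orbit_convex f (l ` X \<union> t ` W)"
      using l away away' by (intro orbit_convex_Un) (auto simp: labelling_def)
    fix w s assume w: "w \<in> W" and s: "s \<in> l ` X \<union> t ` W"
    show "t w \<noteq> f s \<and> s \<noteq> f (t w)"
    proof (cases "s \<in> l ` X")
      case True
      then have "f s \<notin> t ` W" "f (t w) \<notin> l ` X"
        using away[of s 1] away'[OF imageI[OF w], of 1] by simp_all
      then show ?thesis using True imageI[OF w, of t] by metis
    next
      case False
      then obtain w' where "s = Inr (c w', 0)" using s by (auto simp: t_def)
      then show ?thesis using e by (auto simp: f t_def)
    qed
  qed
qed

section \<open>Coherent configurations\<close>

text \<open>
  A triangle consists of an \<open>f\<close>-edge from \<open>a\<close> to \<open>b\<close>, a \<open>g\<close>-edge from \<open>b\<close> to \<open>c\<close> and a \<open>k\<close>-edge from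
  \<open>c\<close> back to \<open>a\<close>. On a total labelling, the triangles close up precisely if the permutations
  induced on the vertices satisfy \<open>KGF = 1\<close>; coherence is the trace of this on a partial one.
\<close>

definition two_imply_third :: "bool \<Rightarrow> bool \<Rightarrow> bool \<Rightarrow> bool" where
  "two_imply_third F G K \<longleftrightarrow> (F \<and> G \<longrightarrow> K) \<and> (G \<and> K \<longrightarrow> F) \<and> (K \<and> F \<longrightarrow> G)"

definition coherent where
  "coherent f g k X p q r \<longleftrightarrow> (\<forall>a\<in>X. \<forall>b\<in>X. \<forall>c\<in>X.
     two_imply_third (p b = f (p a)) (q c = g (q b)) (r a = k (r c)))"

definition config where
  "config B f g k X p q r \<longleftrightarrow> labelling B f X p \<and> labelling B g X q \<and> labelling B k X r
     \<and> coherent f g k X p q r \<and> infinite (- X)"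

text \<open>
  Rotation and reversal of triangles preserve configurations. Every construction below is
  therefore carried out for one edge type and one direction only.
\<close>

lemma config_rotate:
  assumes "config B f g k X p q r" shows "config B g k f X q r p"
proof -
  have "coherent g k f X q r p"
    using assms unfolding config_def coherent_def two_imply_third_def by metis
  then show ?thesis using assms by (simp add: config_def)
qed

lemma eq_inv_iff: "bij f \<Longrightarrow> s = invf f t \<longleftrightarrow> t = f s"
  by (metis bij_inv_eq_iff)

lemma config_reverse:
  assumes "config B f g k X p q r" shows "config B (invf f) (invf k) (invf g) X p r q"
proof -
  have bij: "bij f" "bij g" "bij k"
    using assms by (auto simp: config_def labelling_def lifted_bij)
  have "coherent f g k X p q r" using assms by (simp add: config_def)
  then have "coherent (invf f) (invf k) (invf g) X p r q"
    unfolding coherent_def two_imply_third_def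
      eq_inv_iff[OF bij(1)] eq_inv_iff[OF bij(2)] eq_inv_iff[OF bij(3)] by metis
  then show ?thesis using assms by (simp add: config_def labelling_inv)
qed

text \<open>
  An extension may rename provisional labels, and with this change edges between old
  vertices. Permanent labels stay, so they have a limit.
\<close>

definition keeps :: "'v set \<Rightarrow> ('v \<Rightarrow> 'p label) \<Rightarrow> ('v \<Rightarrow> 'p label) \<Rightarrow> bool" where
  "keeps X l l' \<longleftrightarrow> (\<forall>x\<in>X. \<forall>s. l x = Inl s \<longrightarrow> l' x = Inl s)"

definition extends where
  "extends X p q r X' p' q' r' \<longleftrightarrow> X \<subseteq> X' \<and> keeps X p p' \<and> keeps X q q' \<and> keeps X r r'"

lemma extends_refl: "extends X p q r X p q r"
  by (simp add: extends_def keeps_def)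

lemma extends_trans:
  "extends X p q r X' p' q' r' \<Longrightarrow> extends X' p' q' r' X'' p'' q'' r''
    \<Longrightarrow> extends X p q r X'' p'' q'' r''"
  unfolding extends_def keeps_def by blast

lemma extends_rotate: "extends X p q r X' p' q' r' \<longleftrightarrow> extends X q r p X' q' r' p'"
  unfolding extends_def by blast

lemma extends_swap: "extends X p q r X' p' q' r' \<longleftrightarrow> extends X p r q X' p' r' q'"
  unfolding extends_def by blast

section \<open>Adding vertices\<close>

text \<open>
  New vertices with prescribed first labels are harmless if these have no \<open>f\<close>-edges to old
  vertices: with fresh labels in the other two coordinates, a triangle with two edges that
  meets a new vertex would need a \<open>g\<close>-edge or a \<open>k\<close>-edge there. This allows for a whole finite
  orbit at once, which orbit-convexity requires.
\<close>

lemma add_isolated: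
  assumes cfg: "config B f g k X p q r"
    and W: "finite W" "W \<inter> X = {}" and inj: "inj_on t W"
    and C: "orbit_convex f (t ` W)"
    and sep: "\<And>a n. a \<in> p ` X \<Longrightarrow> (f ^^ n) a \<notin> t ` W"
    and sep': "\<And>c n. c \<in> t ` W \<Longrightarrow> (f ^^ n) c \<notin> p ` X"
  shows "\<exists>p' q' r'. config B f g k (X \<union> W) p' q' r' \<and> extends X p q r (X \<union> W) p' q' r'
           \<and> p' ` W = t ` W"
proof -
  have lab: "labelling B f X p" "labelling B g X q" "labelling B k X r"
    using cfg by (auto simp: config_def)
  define upd where "upd l t = (\<lambda>x. if x \<in> W then t x else l x)" for l t :: "'b \<Rightarrow> 'a label"
  have im: "upd l t ` (X \<union> W) = l ` X \<union> t ` W" for l t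
    using W(2) by (force simp: upd_def)
  have labW: "labelling B f (X \<union> W) (upd l t)"
    if "labelling B f X l" "inj_on t W" "t ` W \<inter> l ` X = {}" "orbit_convex f (l ` X \<union> t ` W)"
    for f l t
  proof -
    have "inj_on (upd l t) (X \<union> W)"
      using that W(2) by (auto simp: labelling_def inj_on_def upd_def)
    moreover have "finite (l ` X \<union> t ` W - Inl ` B)"
      using that W(1) by (simp add: Un_Diff labelling_def)
    ultimately show ?thesis using that unfolding labelling_def im by blast
  qed
  obtain tq where tq: "inj_on tq W" "tq ` W \<inter> q ` X = {}" "orbit_convex g (q ` X \<union> tq ` W)"
    "\<And>w s. w \<in> W \<Longrightarrow> s \<in> q ` X \<union> tq ` W \<Longrightarrow> tq w \<noteq> g s \<and> s \<noteq> g (tq w)"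
    using fresh_labels[OF lab(2) W(1)] by blast
  obtain tr where tr: "inj_on tr W" "tr ` W \<inter> r ` X = {}" "orbit_convex k (r ` X \<union> tr ` W)"
    "\<And>w s. w \<in> W \<Longrightarrow> s \<in> r ` X \<union> tr ` W \<Longrightarrow> tr w \<noteq> k s \<and> s \<noteq> k (tr w)"
    using fresh_labels[OF lab(3) W(1)] by blast
  have "t ` W \<inter> p ` X = {}" using sep[of _ 0] by auto
  moreover have "orbit_convex f (p ` X \<union> t ` W)"
    using lab(1) C sep sep' by (intro orbit_convex_Un) (simp_all add: labelling_def)
  ultimately have pq: "labelling B f (X \<union> W) (upd p t)"
    using labW[OF lab(1) inj] by blast
  have qr: "labelling B g (X \<union> W) (upd q tq)" "labelling B k (X \<union> W) (upd r tr)"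
    using labW lab tq(1-3) tr(1-3) by blast+
  have imm: "upd l t x \<in> l ` X \<union> t ` W" if "x \<in> X \<union> W" for l t x
    using that im by blast
  have updW: "upd l t x = t x" if "x \<in> W" for l t x using that by (simp add: upd_def)
  have noq: "upd q tq c \<noteq> g (upd q tq b)" if "b \<in> X \<union> W" "c \<in> X \<union> W" "b \<in> W \<or> c \<in> W" for b c
    using that(3)
  proof
    assume "b \<in> W" then show ?thesis using tq(4)[OF _ imm[OF that(2)], of b] updW by metis
  next
    assume "c \<in> W" then show ?thesis using tq(4)[OF _ imm[OF that(1)], of c] updW by metis
  qed
  have nor: "upd r tr c \<noteq> k (upd r tr b)" if "b \<in> X \<union> W" "c \<in> X \<union> W" "b \<in> W \<or> c \<in> W" for b c
    using that(3)
  proof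
    assume "b \<in> W" then show ?thesis using tr(4)[OF _ imm[OF that(2)], of b] updW by metis
  next
    assume "c \<in> W" then show ?thesis using tr(4)[OF _ imm[OF that(1)], of c] updW by metis
  qed
  have nop: "upd p t b \<noteq> f (upd p t a)" if "a \<in> X \<union> W" "b \<in> X \<union> W" "a \<in> W \<longleftrightarrow> b \<notin> W" for a b
  proof (cases "a \<in> W")
    case True
    then have "f (t a) \<noteq> p b" using sep'[of "t a" 1] that by auto
    then show ?thesis using True that by (auto simp: upd_def)
  next
    case False
    then have "f (p a) \<noteq> t b" using sep[of "p a" 1] that by auto
    then show ?thesis using False that by (auto simp: upd_def)
  qed
  have "coherent f g k (X \<union> W) (upd p t) (upd q tq) (upd r tr)"
    unfolding coherent_def
  proof (intro ballI)
    fix a b c assume abc: "a \<in> X \<union> W" "b \<in> X \<union> W" "c \<in> X \<union> W"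
    let ?F = "upd p t b = f (upd p t a)" and ?G = "upd q tq c = g (upd q tq b)"
      and ?K = "upd r tr a = k (upd r tr c)"
    show "two_imply_third ?F ?G ?K"
    proof (cases "a \<in> W \<or> b \<in> W \<or> c \<in> W")
      case True
      then show ?thesis using abc noq[of b c] nor[of c a] nop[of a b] unfolding two_imply_third_def by argo
    next
      case False
      then have "a \<in> X" "b \<in> X" "c \<in> X" using abc by auto
      moreover have "coherent f g k X p q r" using cfg by (simp add: config_def)
      ultimately show ?thesis using False unfolding coherent_def upd_def by simp
    qed
  qed
  moreover have "infinite (- (X \<union> W))"
  proof -
    have "- (X \<union> W) = - X - W" by auto
    then show ?thesis using cfg W(1) by (simp add: config_def Diff_infinite_finite del: Compl_Un)
  qed
  ultimately have "config B f g k (X \<union> W) (upd p t) (upd q tq) (upd r tr)"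
    using pq qr by (simp add: config_def)
  moreover have "extends X p q r (X \<union> W) (upd p t) (upd q tq) (upd r tr)"
    using W(2) by (auto simp: extends_def keeps_def upd_def)
  moreover have "upd p t ` W = t ` W" by (simp add: upd_def)
  ultimately show ?thesis by blast
qed

text \<open>
  The new vertex \<open>w\<close> has an \<open>f\<close>-edge from \<open>u\<close>, no other \<open>f\<close>-edge, no \<open>k\<close>-edge, and a \<open>g\<close>-edge
  exactly to a \<open>c\<close> that has a \<open>k\<close>-edge to \<open>u\<close>. Hence the only new triangle with two edges is
  \<open>u\<close>, \<open>w\<close>, \<open>c\<close>, and it has all three.
\<close>

lemma coherent_insert:
  assumes coh: "coherent f g k X p q r" and w: "w \<notin> X" and r: "inj_on r X" and u: "u \<in> X"
    and f_in: "\<And>a. a \<in> X \<Longrightarrow> pw = f (p a) \<longleftrightarrow> a = u"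
    and f_out: "\<And>b. b \<in> X \<Longrightarrow> p b \<noteq> f pw" "pw \<noteq> f pw"
    and g_out: "\<And>c. c \<in> X \<Longrightarrow> q c = g qw \<longleftrightarrow> r u = k (r c)"
    and g_in: "\<And>b. b \<in> X \<Longrightarrow> qw \<noteq> g (q b)" "qw \<noteq> g qw"
    and k: "\<And>c. c \<in> X \<Longrightarrow> rw \<noteq> k (r c)" "\<And>c. c \<in> X \<Longrightarrow> r c \<noteq> k rw" "rw \<noteq> k rw"
  shows "coherent f g k (insert w X) (p(w := pw)) (q(w := qw)) (r(w := rw))"
  unfolding coherent_def
proof (intro ballI)
  fix a b c assume abc: "a \<in> insert w X" "b \<in> insert w X" "c \<in> insert w X"
  let ?p = "p(w := pw)" and ?q = "q(w := qw)" and ?r = "r(w := rw)"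
  have F: "?p b = f (?p a) \<longleftrightarrow> (if b = w then a = u else a \<noteq> w \<and> p b = f (p a))"
    using abc f_in f_out u w by auto
  have G: "?q c = g (?q b) \<longleftrightarrow> c \<noteq> w \<and> (if b = w then r u = k (r c) else q c = g (q b))"
    using abc g_in g_out by auto
  have K: "?r a = k (?r c) \<longleftrightarrow> a \<noteq> w \<and> c \<noteq> w \<and> r a = k (r c)"
    using abc k by auto
  consider "a \<in> X" "b \<in> X" "c \<in> X" | "a = w" "b \<noteq> w" | "c = w" "a \<noteq> w" "b \<noteq> w" | "b = w"
    using abc by blast
  then show "two_imply_third (?p b = f (?p a)) (?q c = g (?q b)) (?r a = k (?r c))"
  proof cases
    case 1
    then have "a \<noteq> w" "b \<noteq> w" "c \<noteq> w" using w by auto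
    with 1 show ?thesis using coh unfolding F G K coherent_def by simp
  next
    case 4
    then show ?thesis unfolding F G K two_imply_third_def using abc inj_onD[OF r, of a u] u w by auto
  qed (unfold F G K two_imply_third_def, auto)
qed

lemma fresh_label:
  assumes "labelling B f X l"
  obtains s where "s \<notin> l ` X" "orbit_convex f (insert s (l ` X))" "s \<noteq> f s"
    "\<And>x. x \<in> X \<Longrightarrow> s \<noteq> f (l x) \<and> l x \<noteq> f s"
proof (rule fresh_labels[OF assms, of "{()}"])
  fix t assume t: "t ` {()} \<inter> l ` X = {}" "orbit_convex f (l ` X \<union> t ` {()})"
    "\<And>w s. w \<in> {()} \<Longrightarrow> s \<in> l ` X \<union> t ` {()} \<Longrightarrow> t w \<noteq> f s \<and> s \<noteq> f (t w)"
  show ?thesis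
  proof (rule that[of "t ()"])
    show "t () \<notin> l ` X" "orbit_convex f (insert (t ()) (l ` X))" using t(1,2) by simp_all
    show "t () \<noteq> f (t ())" using t(3)[of "()" "t ()"] by simp
    show "t () \<noteq> f (l x) \<and> l x \<noteq> f (t ())" if "x \<in> X" for x
      using t(3)[of "()" "l x"] that by simp
  qed
qed simp

text \<open>
  An \<open>f\<close>-chain can be continued by a vertex \<open>w\<close> after its last vertex \<open>u\<close>. If some \<open>c\<close> has a
  \<open>k\<close>-edge to \<open>u\<close>, the triangle forces the label of \<open>w\<close> in the second coordinate to be the
  \<open>g\<close>-predecessor of the label of \<open>c\<close>. Coherence shows that this label is free, and
  orbit-convexity that it has no further neighbours. All other labels are fresh. The list of
  absent edges at \<open>w\<close> is what makes it possible to attach another chain to \<open>w\<close>.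
\<close>

lemma add_successor:
  assumes cfg: "config B f g k X p q r" and u: "u \<in> X" and new: "f (p u) \<notin> p ` X"
  obtains w qw rw where "w \<notin> X"
    "config B f g k (insert w X) (p(w := f (p u))) (q(w := qw)) (r(w := rw))"
    "extends X p q r (insert w X) (p(w := f (p u))) (q(w := qw)) (r(w := rw))"
    "rw \<noteq> k rw" "qw \<noteq> g qw"
    "\<And>y. y \<in> X \<Longrightarrow> rw \<noteq> k (r y) \<and> r y \<noteq> k rw \<and> qw \<noteq> g (q y)"
proof -
  have lab: "labelling B f X p" "labelling B g X q" "labelling B k X r"
    and coh: "coherent f g k X p q r" and inf: "infinite (- X)"
    using cfg unfolding config_def by blast+
  have bij: "bij f" "bij g" "bij k" using lab unfolding labelling_def using lifted_bij by blast+
  note inj = bij[THEN bij_is_inj, THEN inj_eq]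
  have conv: "orbit_convex f (p ` X)" "orbit_convex g (q ` X)" "orbit_convex k (r ` X)"
    and inj_on: "inj_on p X" "inj_on q X" "inj_on r X"
    using lab unfolding labelling_def by blast+
  have "- X \<noteq> {}" using inf by (metis finite.emptyI)
  then obtain w where w: "w \<notin> X" by blast
  obtain rw where rw: "rw \<notin> r ` X" "orbit_convex k (insert rw (r ` X))" "rw \<noteq> k rw"
    "\<And>x. x \<in> X \<Longrightarrow> rw \<noteq> k (r x) \<and> r x \<noteq> k rw"
    using fresh_label[OF lab(3)] by blast
  obtain qw where qw: "qw \<notin> q ` X" "orbit_convex g (insert qw (q ` X))" "qw \<noteq> g qw"
    "\<And>b. b \<in> X \<Longrightarrow> qw \<noteq> g (q b)" "\<And>c. c \<in> X \<Longrightarrow> q c = g qw \<longleftrightarrow> r u = k (r c)"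
  proof (cases "\<exists>c\<in>X. r u = k (r c)")
    case True
    then obtain c where c: "c \<in> X" "r u = k (r c)" by blast
    \<comment> \<open>The label that closes the triangle of u, w and c.\<close>
    define y where "y = invf g (q c)"
    have y: "g y = q c" using bij(2) by (simp add: y_def bij_is_surj surj_f_inv_f)
    have y_new: "y \<notin> q ` X"
    proof
      assume "y \<in> q ` X"
      then obtain b where "b \<in> X" "q c = g (q b)" using y by auto
      then have "p b = f (p u)" using coh c u unfolding coherent_def two_imply_third_def by blast
      then show False using new \<open>b \<in> X\<close> by (metis imageI)
    qed
    show ?thesis
    proof (rule that[of y])
      show "orbit_convex g (insert y (q ` X))"
      proof -
        have "orbit_convex (invf g) (insert (invf g (q c)) (q ` X))"
          using c conv(2) bij(2) by (intro orbit_convex_insert_succ orbit_convex_inv_imp bij_imp_bij_inv) auto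
        then have "orbit_convex (invf (invf g)) (insert y (q ` X))"
          unfolding y_def by (rule orbit_convex_inv_imp[OF bij_imp_bij_inv[OF bij(2)]])
        then show ?thesis using bij(2) by (simp add: inv_inv_eq)
      qed
      show "y \<noteq> g y" using y y_new imageI[OF c(1), of q] by metis
      show "y \<noteq> g (q b)" if "b \<in> X" for b
      proof
        assume eq: "y = g (q b)"
        then have "g (q b) \<in> q ` X"
          using orbit_convex_gap[OF conv(2), of "q b"] that c y by (metis imageI)
        then show False using eq y_new by simp
      qed
      show "q c' = g y \<longleftrightarrow> r u = k (r c')" if "c' \<in> X" for c'
      proof
        assume "q c' = g y"
        then have "c' = c" using y inj_onD[OF inj_on(2)] that c by metis
        then show "r u = k (r c')" using c by simp
      next
        assume "r u = k (r c')"
        then have "r c' = r c" using c inj(3) by simp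
        then have "c' = c" using inj_onD[OF inj_on(3)] that c by metis
        then show "q c' = g y" using y by simp
      qed
    qed (fact y_new)
  next
    case False
    obtain s where s: "s \<notin> q ` X" "orbit_convex g (insert s (q ` X))" "s \<noteq> g s"
      "\<And>x. x \<in> X \<Longrightarrow> s \<noteq> g (q x) \<and> q x \<noteq> g s"
      using fresh_label[OF lab(2)] by blast
    show ?thesis
    proof (rule that[of s])
      show "s \<noteq> g (q b)" if "b \<in> X" for b using s(4)[OF that] by blast
      show "q c = g s \<longleftrightarrow> r u = k (r c)" if "c \<in> X" for c using s(4)[OF that] False that by blast
    qed (fact s)+
  qed
  have f_out: "p b \<noteq> f (f (p u))" if "b \<in> X" for b
    using orbit_convex_gap[OF conv(1), of "p u"] u new that by (metis imageI)
  have f_loop: "f (p u) \<noteq> f (f (p u))" using inj(1) u new by (metis imageI)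
  have f_in: "f (p u) = f (p a) \<longleftrightarrow> a = u" if "a \<in> X" for a
    unfolding inj(1) using inj_on(1) u that by (auto dest: inj_onD)
  have "coherent f g k (insert w X) (p(w := f (p u))) (q(w := qw)) (r(w := rw))"
    by (rule coherent_insert[OF coh w inj_on(3) u f_in f_out f_loop qw(5,4,3) _ _ rw(3)])
       (simp_all add: rw(4))
  moreover have "labelling B f (insert w X) (p(w := f (p u)))"
    using labelling_insert[OF lab(1) w new] orbit_convex_insert_succ[OF bij(1) conv(1), of "p u"] u
    by blast
  moreover have "labelling B g (insert w X) (q(w := qw))" "labelling B k (insert w X) (r(w := rw))"
    using labelling_insert[OF lab(2) w qw(1,2)] labelling_insert[OF lab(3) w rw(1,2)] by simp_all
  moreover have "infinite (- insert w X)"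
    using inf by (metis Compl_insert infinite_remove)
  ultimately have "config B f g k (insert w X) (p(w := f (p u))) (q(w := qw)) (r(w := rw))"
    by (simp add: config_def)
  moreover have "extends X p q r (insert w X) (p(w := f (p u))) (q(w := qw)) (r(w := rw))"
    using w by (auto simp: extends_def keeps_def)
  ultimately show ?thesis
    using that[OF w] qw(3,4) rw(3,4) by blast
qed

text \<open>
  Reversing all triangles turns this into the addition of a successor.
\<close>

lemma add_predecessor:
  assumes cfg: "config B f g k X p q r" and v: "f s \<in> p ` X" and new: "s \<notin> p ` X"
  obtains w qw rw where "w \<notin> X"
    "config B f g k (insert w X) (p(w := s)) (q(w := qw)) (r(w := rw))"
    "extends X p q r (insert w X) (p(w := s)) (q(w := qw)) (r(w := rw))"
    "qw \<noteq> g qw" "rw \<noteq> k rw"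
    "\<And>y. y \<in> X \<Longrightarrow> q y \<noteq> g qw \<and> qw \<noteq> g (q y) \<and> r y \<noteq> k rw"
proof -
  have bij: "bij f" "bij g" "bij k"
    using cfg by (auto simp: config_def labelling_def lifted_bij)
  obtain v where v: "v \<in> X" "p v = f s" using v by auto
  then have s: "invf f (p v) = s" using bij(1) by (simp add: bij_is_inj)
  have new': "invf f (p v) \<notin> p ` X" using new s by simp
  show ?thesis
  proof (rule add_successor[OF config_reverse[OF cfg] v(1) new'], unfold s)
    fix w rw qw assume w: "w \<notin> X"
      "config B (invf f) (invf k) (invf g) (insert w X) (p(w := s)) (r(w := rw)) (q(w := qw))"
      "extends X p r q (insert w X) (p(w := s)) (r(w := rw)) (q(w := qw))"
      and loop: "qw \<noteq> invf g qw" "rw \<noteq> invf k rw"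
      and no: "\<And>y. y \<in> X \<Longrightarrow> qw \<noteq> invf g (q y) \<and> q y \<noteq> invf g qw \<and> rw \<noteq> invf k (r y)"
    show ?thesis
    proof (rule that[of w qw rw])
      show "config B f g k (insert w X) (p(w := s)) (q(w := qw)) (r(w := rw))"
        using config_reverse[OF w(2)] bij by (simp add: inv_inv_eq)
      show "extends X p q r (insert w X) (p(w := s)) (q(w := qw)) (r(w := rw))"
        using w(3) extends_swap by blast
      show "qw \<noteq> g qw" "rw \<noteq> k rw"
        using loop unfolding eq_inv_iff[OF bij(2)] eq_inv_iff[OF bij(3)] by blast+
      show "q y \<noteq> g qw \<and> qw \<noteq> g (q y) \<and> r y \<noteq> k rw" if "y \<in> X" for y
        using no[OF that] unfolding eq_inv_iff[OF bij(2)] eq_inv_iff[OF bij(3)] by blast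
    qed (fact w(1))
  qed
qed

section \<open>Every label can be assigned\<close>

lemma add_vertex:
  assumes cfg: "config B f g k X p q r" and v: "v \<notin> X"
  shows "\<exists>p' q' r'. config B f g k (insert v X) p' q' r' \<and> extends X p q r (insert v X) p' q' r'"
proof -
  have lab: "labelling B f X p" using cfg by (simp add: config_def)
  obtain s where s: "s \<notin> p ` X" "orbit_convex f (insert s (p ` X))" "s \<noteq> f s"
    "\<And>x. x \<in> X \<Longrightarrow> s \<noteq> f (p x) \<and> p x \<noteq> f s"
    using fresh_label[OF lab] by blast
  have conv: "(f ^^ m) a \<in> insert s (p ` X)"
    if "a \<in> insert s (p ` X)" "(f ^^ n) a \<in> insert s (p ` X)" "m \<le> n" for a n m
    by (rule s(2)[unfolded orbit_convex_def, rule_format, OF that])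
  have no_in: "f t \<noteq> s" if t: "t \<in> insert s (p ` X)" for t
  proof (cases "t = s")
    case False
    with t obtain x where "x \<in> X" "t = p x" by blast
    then show ?thesis using s(4)[of x] by metis
  qed (use s(3) in metis)
  have no_out: "f s \<notin> insert s (p ` X)"
  proof
    assume "f s \<in> insert s (p ` X)"
    then obtain x where "x \<in> X" "p x = f s" using s(3) by (metis imageE insertE)
    then show False using s(4)[of x] by blast
  qed
  have away: "(f ^^ n) a \<noteq> s" if a: "a \<in> p ` X" for a n
  proof (cases n)
    case 0 then show ?thesis using a s(1) by auto
  next
    case (Suc m)
    show ?thesis
    proof
      assume eq: "(f ^^ n) a = s"
      then have "(f ^^ m) a \<in> insert s (p ` X)" using conv[of a n m] a Suc by simp
      then show False using no_in eq Suc by simp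
    qed
  qed
  have no_return: "(f ^^ n) s \<notin> insert s (p ` X)" if "n > 0" for n
  proof
    assume "(f ^^ n) s \<in> insert s (p ` X)"
    then show False using conv[of s n 1] that no_out by simp
  qed
  have "orbit_convex f ((\<lambda>_. s) ` {v})"
    unfolding orbit_convex_def
  proof (intro ballI allI impI)
    fix a and n m :: nat assume "a \<in> (\<lambda>_. s) ` {v}" "(f ^^ n) a \<in> (\<lambda>_. s) ` {v}" "m \<le> n"
    then have "a = s" "n = 0" using no_return[of n] by auto
    then show "(f ^^ m) a \<in> (\<lambda>_. s) ` {v}" using \<open>m \<le> n\<close> by simp
  qed
  moreover have "(f ^^ n) s \<notin> p ` X" for n
    using no_return[of n] s(1) by (cases n) auto
  ultimately have "\<exists>p' q' r'. config B f g k (X \<union> {v}) p' q' r'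
      \<and> extends X p q r (X \<union> {v}) p' q' r' \<and> p' ` {v} = (\<lambda>_. s) ` {v}"
    using v away by (intro add_isolated[OF cfg]) simp_all
  then show ?thesis by auto
qed

lemma reach_forward:
  assumes "config B f g k X p q r" "a \<in> p ` X"
  shows "\<exists>X' p' q' r'. config B f g k X' p' q' r' \<and> extends X p q r X' p' q' r'
           \<and> (f ^^ n) a \<in> p' ` X'"
proof (induction n)
  case 0
  have "(f ^^ 0) a \<in> p ` X" using assms(2) by simp
  with assms(1) extends_refl[of X p q r] show ?case by (intro exI conjI)
next
  case (Suc n)
  then obtain X' p' q' r' where 1: "config B f g k X' p' q' r'" "extends X p q r X' p' q' r'"
    "(f ^^ n) a \<in> p' ` X'" by blast
  then obtain u where u: "u \<in> X'" "(f ^^ n) a = p' u" by blast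
  show ?case
  proof (cases "f (p' u) \<in> p' ` X'")
    case True
    then have "(f ^^ Suc n) a \<in> p' ` X'" using u by simp
    with 1(1,2) show ?thesis by (intro exI conjI)
  next
    case False
    obtain w qw rw where w: "w \<notin> X'"
      "config B f g k (insert w X') (p'(w := f (p' u))) (q'(w := qw)) (r'(w := rw))"
      "extends X' p' q' r' (insert w X') (p'(w := f (p' u))) (q'(w := qw)) (r'(w := rw))"
      by (rule add_successor[OF 1(1) u(1) False])
    have "(f ^^ Suc n) a \<in> (p'(w := f (p' u))) ` insert w X'" using u by simp
    with w(2) extends_trans[OF 1(2) w(3)] show ?thesis by (intro exI conjI)
  qed
qed

lemma reach_backward:
  assumes "config B f g k X p q r" "(f ^^ n) s \<in> p ` X"
  shows "\<exists>X' p' q' r'. config B f g k X' p' q' r' \<and> extends X p q r X' p' q' r' \<and> s \<in> p' ` X'"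
  using assms(2)
proof (induction n arbitrary: s)
  case 0
  then have "s \<in> p ` X" by simp
  with assms(1) extends_refl[of X p q r] show ?case by (intro exI conjI)
next
  case (Suc n)
  then have "(f ^^ n) (f s) \<in> p ` X" by (simp add: funpow_swap1)
  from Suc.IH[OF this] obtain X' p' q' r' where 1: "config B f g k X' p' q' r'"
    "extends X p q r X' p' q' r'" "f s \<in> p' ` X'" by blast
  show ?case
  proof (cases "s \<in> p' ` X'")
    case True
    with 1(1,2) show ?thesis by (intro exI conjI)
  next
    case False
    obtain w qw rw where w: "w \<notin> X'"
      "config B f g k (insert w X') (p'(w := s)) (q'(w := qw)) (r'(w := rw))"
      "extends X' p' q' r' (insert w X') (p'(w := s)) (q'(w := qw)) (r'(w := rw))"
      by (rule add_predecessor[OF 1(1,3) False])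
    have "s \<in> (p'(w := s)) ` insert w X'" by simp
    with w(2) extends_trans[OF 1(2) w(3)] show ?thesis by (intro exI conjI)
  qed
qed

text \<open>
  If the orbit of \<open>s\<close> contains an assigned label, walking along the orbit from there reaches
  \<open>s\<close>. Otherwise \<open>s\<close> enters on an isolated vertex, together with its whole orbit if that is finite.
\<close>

lemma assign_label:
  assumes cfg: "config B f g k X p q r"
  shows "\<exists>X' p' q' r'. config B f g k X' p' q' r' \<and> extends X p q r X' p' q' r' \<and> s \<in> p' ` X'"
proof -
  consider (forward) a n where "a \<in> p ` X" "(f ^^ n) a = s" | (backward) n where "(f ^^ n) s \<in> p ` X"
    | (apart) "\<And>a n. a \<in> p ` X \<Longrightarrow> (f ^^ n) a \<noteq> s" "\<And>n. (f ^^ n) s \<notin> p ` X" by blast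
  then show ?thesis
  proof cases
    case forward
    then show ?thesis using reach_forward[OF cfg] by blast
  next
    case backward
    then show ?thesis using reach_backward[OF cfg] by blast
  next
    case apart
    obtain C where C: "finite C" "s \<in> C" "orbit_convex f C"
      "\<And>c. c \<in> C \<Longrightarrow> \<exists>n m. (f ^^ n) c = s \<and> c = (f ^^ m) s"
    proof (cases "\<exists>n>0. (f ^^ n) s = s")
      case True
      then obtain N where N: "N > 0" "(f ^^ N) s = s" by blast
      define C where "C = (\<lambda>n. (f ^^ n) s) ` {..<N}"
      have mod: "(f ^^ n) s = (f ^^ (n mod N)) s" for n using N(2) funpow_mod_eq by metis
      have inC: "(f ^^ n) s \<in> C" for n
        unfolding C_def by (subst mod) (use N(1) in simp)
      show ?thesis
      proof (rule that[of C])
        show "finite C" by (simp add: C_def)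
        show "s \<in> C" using inC[of 0] by simp
        show "orbit_convex f C" unfolding orbit_convex_def
        proof (intro ballI allI impI)
          fix c and m :: nat assume "c \<in> C"
          then obtain n where "c = (f ^^ n) s" by (auto simp: C_def)
          then show "(f ^^ m) c \<in> C" using inC[of "m + n"] by (simp add: funpow_add)
        qed
        show "\<exists>n m. (f ^^ n) c = s \<and> c = (f ^^ m) s" if c: "c \<in> C" for c
        proof -
          obtain n where n: "c = (f ^^ n) s" "n < N" using c by (auto simp: C_def)
          then have "(f ^^ (N - n)) c = s" using funpow_add[of "N - n" n f] N(2) by simp
          then show ?thesis using n by blast
        qed
      qed
    next
      case False
      show ?thesis
      proof (rule that[of "{s}"])
        show "orbit_convex f {s}" using False unfolding orbit_convex_def
          by (metis bot_nat_0.not_eq_extremum le_zero_eq singletonD)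
        show "\<exists>n m. (f ^^ n) c = s \<and> c = (f ^^ m) s" if "c \<in> {s}" for c
          using that by (intro exI[of _ 0]) simp
      qed simp_all
    qed
    have "infinite (- X)" using cfg by (simp add: config_def)
    then obtain W where W: "W \<subseteq> - X" "finite W" "card W = card C"
      using infinite_arbitrarily_large by blast
    then obtain t where t: "bij_betw t W C" using C(1) finite_same_card_bij by metis
    have "\<exists>p' q' r'. config B f g k (X \<union> W) p' q' r' \<and> extends X p q r (X \<union> W) p' q' r' \<and> p' ` W = t ` W"
    proof (rule add_isolated[OF cfg W(2)])
      show "W \<inter> X = {}" using W(1) by blast
      show "inj_on t W" using t by (simp add: bij_betw_def)
      have tW: "t ` W = C" using t by (simp add: bij_betw_def)
      then show "orbit_convex f (t ` W)" using C(3) by simp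
      show "(f ^^ n) a \<notin> t ` W" if "a \<in> p ` X" for a n
      proof
        assume "(f ^^ n) a \<in> t ` W"
        then obtain m where "(f ^^ m) ((f ^^ n) a) = s" using C(4) tW by blast
        then show False using apart(1)[OF that, of "m + n"] by (simp add: funpow_add)
      qed
      show "(f ^^ n) c \<notin> p ` X" if c: "c \<in> t ` W" for c n
      proof -
        obtain m where "c = (f ^^ m) s" using C(4) tW c by blast
        then show ?thesis using apart(2)[of "n + m"] by (simp add: funpow_add)
      qed
    qed
    then obtain p' q' r' where *: "config B f g k (X \<union> W) p' q' r'"
      "extends X p q r (X \<union> W) p' q' r'" "p' ` W = t ` W" by blast
    have "t ` W = C" using t by (simp add: bij_betw_def)
    then have "s \<in> p' ` (X \<union> W)" using C(2) *(3) by (simp add: image_Un)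
    with * show ?thesis by blast
  qed
qed

section \<open>Every vertex can get permanent labels\<close>

text \<open>
  Suppose the main \<open>f\<close>-chain ends at \<open>w\<close> and a reserve chain starts at \<open>w'\<close>. Splicing the
  reserve chain behind \<open>w\<close> turns its labels into permanent ones. It creates a single new edge,
  from \<open>w\<close> to \<open>w'\<close>; the triangles that contain this edge have no second one, because \<open>w\<close> has no
  incoming \<open>k\<close>-edge and \<open>w'\<close> no outgoing \<open>g\<close>-edge.
\<close>

lemma join_chains:
  assumes cfg: "config B f g k X p q r" and f: "f = lift 1 f0"
    and w: "w \<in> X" "p w = Inl m" and w': "w' \<in> X" "p w' = Inr (j, l)"
    and tail: "\<And>n. n > 0 \<Longrightarrow> Inl ((f0 ^^ n) m) \<notin> p ` X"
    and first: "\<And>i. Inr (j, i) \<in> p ` X \<Longrightarrow> l \<le> i"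
    and no_k: "\<And>y. y \<in> X \<Longrightarrow> r w \<noteq> k (r y)" and no_g: "\<And>y. y \<in> X \<Longrightarrow> q y \<noteq> g (q w')"
  defines "\<tau> \<equiv> \<lambda>s. case s of Inl a \<Rightarrow> Inl a
      | Inr (j', i) \<Rightarrow> if j' = j then Inl ((f0 ^^ nat (i - l + 1)) m) else s"
  shows "config B f g k X (\<tau> \<circ> p) q r"
proof -
  have lab: "labelling B f X p" and coh: "coherent f g k X p q r"
    using cfg by (simp_all add: config_def)
  have bij: "bij f" and conv: "orbit_convex f (p ` X)" and inj: "inj_on p X"
    using lab unfolding labelling_def using lifted_bij by blast+
  have inj_f: "(f ^^ n) s = (f ^^ n) t \<longleftrightarrow> s = t" for n s t
    using bij by (metis bij_fn bij_is_inj inj_eq)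
  define A where "A = p ` X"
  \<comment> \<open>The unassigned continuation of the main chain, and the reserve chain that moves there.\<close>
  define c where "c n = (Inl ((f0 ^^ n) m) :: 'a label)" for n
  define J where "J = range (\<lambda>i. (Inr (j, i) :: 'a label))"
  have f_c: "(f ^^ n) (c i) = c (n + i)" for n i by (simp add: c_def f funpow_add)
  have c0: "c 0 \<in> A" using imageI[OF w(1), of p] w(2) by (simp add: c_def A_def)
  have c_new: "c n \<notin> A" if "n > 0" for n using tail[OF that] by (simp add: c_def A_def)
  have c_less: "c n \<noteq> c n'" if "n < n'" for n n'
  proof
    assume "c n = c n'"
    then have "(f ^^ n) (c 0) = (f ^^ n) (c (n' - n))" using that by (simp add: f_c)
    then show False using c_new[of "n' - n"] c0 that by (simp add: inj_f)
  qed
  have c_inj: "c n = c n' \<longleftrightarrow> n = n'" for n n' using c_less by (metis nat_neq_iff)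
  have \<tau>_old: "\<tau> s = s" if "s \<notin> J" for s
    using that by (auto simp: \<tau>_def J_def split: sum.split)
  have \<tau>_J: "\<tau> (Inr (j, i)) = c (nat (i - l + 1))" for i by (simp add: \<tau>_def c_def)
  have J_A: "\<exists>N>0. s = Inr (j, l + int N - 1) \<and> \<tau> s = c N" if s: "s \<in> A" "s \<in> J" for s
  proof -
    obtain i where i: "s = Inr (j, i)" using s by (auto simp: J_def)
    then have "l \<le> i" using first s by (simp add: A_def)
    then show ?thesis using i by (intro exI[of _ "nat (i - l + 1)"]) (simp add: \<tau>_J)
  qed
  have J_f: "(f ^^ n) s \<in> J \<longleftrightarrow> s \<in> J" for n s
  proof (cases s)
    case (Inr x)
    then show ?thesis by (cases x) (auto simp: J_def f image_iff algebra_simps intro: exI[of _ "_ - int n"])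
  qed (auto simp: J_def f)
  have down: "Inr (j, l + int N' - 1) \<in> A" if "Inr (j, l + int N - 1) \<in> A" "0 < N'" "N' \<le> N" for N N'
  proof -
    have pow: "(f ^^ n) (Inr (j, l)) = Inr (j, l + int n)" for n by (simp add: f)
    have "Inr (j, l) \<in> A" using imageI[OF w'(1), of p] w'(2) by (simp add: A_def)
    moreover have "(f ^^ (N - 1)) (Inr (j, l)) \<in> A" using that unfolding pow by (simp add: of_nat_diff add_diff_eq)
    ultimately have "(f ^^ (N' - 1)) (Inr (j, l)) \<in> A"
      using conv that unfolding orbit_convex_def A_def by (meson diff_le_mono)
    then show ?thesis using that unfolding pow by (simp add: of_nat_diff add_diff_eq)
  qed
  have in_c: "c N' \<in> \<tau> ` A" if "Inr (j, l + int N - 1) \<in> A" "0 < N'" "N' \<le> N" for N N'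
    using down[OF that] that(2) by (intro image_eqI[OF _ down[OF that]]) (simp add: \<tau>_J)
  have old_in: "s \<in> \<tau> ` A" if "s \<in> A" "s \<notin> J" for s
    using that \<tau>_old by (metis imageI)
  have cases_A: "(s \<in> A \<and> s \<notin> J) \<or> (\<exists>N>0. s = c N \<and> Inr (j, l + int N - 1) \<in> A)"
    if "s \<in> \<tau> ` A" for s
  proof -
    obtain t where t: "t \<in> A" "s = \<tau> t" using \<open>s \<in> \<tau> ` A\<close> by blast
    show ?thesis
    proof (cases "t \<in> J")
      case True
      then show ?thesis using J_A t by metis
    qed (use t \<tau>_old in auto)
  qed
  have conv': "orbit_convex f (\<tau> ` A)"
    unfolding orbit_convex_def
  proof (intro ballI allI impI)
    fix a n i assume a: "a \<in> \<tau> ` A" and n: "(f ^^ n) a \<in> \<tau> ` A" and i: "i \<le> n"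
    from cases_A[OF a] show "(f ^^ i) a \<in> \<tau> ` A"
    proof
      assume old: "a \<in> A \<and> a \<notin> J"
      from cases_A[OF n] show ?thesis
      proof
        assume "(f ^^ n) a \<in> A \<and> (f ^^ n) a \<notin> J"
        then have "(f ^^ i) a \<in> A" using conv i old unfolding orbit_convex_def A_def by blast
        then show ?thesis using old_in J_f old by blast
      next
        assume "\<exists>N>0. (f ^^ n) a = c N \<and> Inr (j, l + int N - 1) \<in> A"
        then obtain N where N: "N > 0" "(f ^^ n) a = c N" "Inr (j, l + int N - 1) \<in> A" by blast
        \<comment> \<open>The segment runs along the old main chain, through its end, into the spliced part.\<close>
        have "N \<le> n"
        proof (rule ccontr)
          assume "\<not> N \<le> n"
          then have "(f ^^ n) a = (f ^^ n) (c (N - n))" using N(2) f_c[of n "N - n"] by simp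
          then have "a = c (N - n)" by (simp add: inj_f)
          then show False using c_new[of "N - n"] old \<open>\<not> N \<le> n\<close> by simp
        qed
        then have "(f ^^ N) ((f ^^ (n - N)) a) = (f ^^ N) (c 0)"
          using N(2) f_c[of N 0] funpow_add[of N "n - N" f] by simp
        then have meet: "(f ^^ (n - N)) a = c 0" by (simp add: inj_f)
        show ?thesis
        proof (cases "i \<le> n - N")
          case True
          then have "(f ^^ i) a \<in> A"
            using conv old meet c0 unfolding orbit_convex_def A_def by metis
          then show ?thesis using old_in J_f old by blast
        next
          case False
          then have "(f ^^ i) a = (f ^^ (i - (n - N))) ((f ^^ (n - N)) a)"
            using funpow_add[of "i - (n - N)" "n - N" f] by simp
          also have "\<dots> = c (i - (n - N))" unfolding meet f_c by simp
          finally show ?thesis using in_c[OF N(3)] False i \<open>N \<le> n\<close> by simp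
        qed
      qed
    next
      assume "\<exists>N>0. a = c N \<and> Inr (j, l + int N - 1) \<in> A"
      then obtain N where N: "N > 0" "a = c N" by blast
      then have "(f ^^ n) a \<notin> A" using c_new by (simp add: f_c)
      then obtain M where M: "(f ^^ n) a = c M" "Inr (j, l + int M - 1) \<in> A"
        using cases_A[OF n] by blast
      then have "M = n + N" using N by (simp add: f_c c_inj)
      then show ?thesis using in_c[OF M(2), of "i + N"] N i by (simp add: f_c)
    qed
  qed
  have \<tau>_edge: "\<tau> (p b) = f (\<tau> (p a)) \<longleftrightarrow> p b = f (p a) \<or> a = w \<and> b = w'"
    if a: "a \<in> X" and b: "b \<in> X" for a b
  proof -
    have aA: "p a \<in> A" "p b \<in> A" using a b by (simp_all add: A_def)
    have iff_w: "a = w \<longleftrightarrow> p a = c 0" "b = w' \<longleftrightarrow> p b = Inr (j, l)"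
      using inj_onD[OF inj] a b w w' by (auto simp: c_def)
    have f_J: "f s \<in> J \<longleftrightarrow> s \<in> J" for s using J_f[of 1 s] by simp
    have c0J: "c 0 \<notin> J" by (auto simp: c_def J_def)
    have fc: "f (c n) = c (Suc n)" for n using f_c[of 1 n] by simp
    have lJ: "Inr (j, l) \<in> J" by (simp add: J_def)
    show ?thesis
    proof (cases "p a \<in> J"; cases "p b \<in> J")
      assume "p a \<in> J" "p b \<in> J"
      then obtain N M where N: "p a = Inr (j, l + int N - 1)" "\<tau> (p a) = c N"
        and M: "p b = Inr (j, l + int M - 1)" "\<tau> (p b) = c M" using J_A aA by metis
      then show ?thesis using \<open>p a \<in> J\<close> c0J iff_w(1) by (auto simp: fc c_inj) (auto simp: f)
    next
      assume J: "p a \<in> J" "p b \<notin> J"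
      then obtain N where N: "\<tau> (p a) = c N" using J_A aA by metis
      then show ?thesis using J \<tau>_old[OF J(2)] f_J[of "p a"] c_new[of "Suc N"] aA lJ iff_w(2)
        by (auto simp: fc)
    next
      assume J: "p a \<notin> J" "p b \<in> J"
      then obtain N where N: "N > 0" "p b = Inr (j, l + int N - 1)" "\<tau> (p b) = c N"
        using J_A aA by metis
      have "\<tau> (p b) = f (\<tau> (p a)) \<longleftrightarrow> f (c (N - 1)) = f (p a)"
        using N \<tau>_old[OF J(1)] by (simp add: fc)
      also have "\<dots> \<longleftrightarrow> c (N - 1) = p a" using inj_f[of 1] by simp
      also have "\<dots> \<longleftrightarrow> N = 1 \<and> p a = c 0" using c_new[of "N - 1"] aA N(1) by (cases "N = 1") auto
      also have "\<dots> \<longleftrightarrow> p b = f (p a) \<or> a = w \<and> b = w'"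
        using N(2) f_J[of "p a"] J iff_w by auto
      finally show ?thesis .
    next
      assume J: "p a \<notin> J" "p b \<notin> J"
      then show ?thesis using \<tau>_old iff_w lJ by auto
    qed
  qed
  have "inj_on \<tau> A"
  proof (rule inj_onI)
    fix s t assume st: "s \<in> A" "t \<in> A" "\<tau> s = \<tau> t"
    show "s = t"
    proof (cases "s \<in> J"; cases "t \<in> J")
      assume "s \<in> J" "t \<in> J"
      then show ?thesis using J_A[OF st(1)] J_A[OF st(2)] st(3) by (auto simp: c_inj)
    next
      assume "s \<in> J" "t \<notin> J"
      then show ?thesis using J_A[OF st(1)] \<tau>_old[of t] st c_new by auto
    next
      assume "s \<notin> J" "t \<in> J"
      then show ?thesis using J_A[OF st(2)] \<tau>_old[of s] st c_new by auto
    qed (use st \<tau>_old in auto)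
  qed
  then have "inj_on (\<tau> \<circ> p) X" using inj by (simp add: A_def comp_inj_on)
  moreover have im: "(\<tau> \<circ> p) ` X = \<tau> ` A" by (auto simp: A_def)
  moreover have \<tau>_B: "\<tau> ` Inl ` B = Inl ` B" by (simp add: \<tau>_def image_image)
  moreover have "Inl ` B \<subseteq> \<tau> ` A"
  proof -
    have "Inl ` B \<subseteq> A" using lab unfolding labelling_def A_def by blast
    then show ?thesis using image_mono \<tau>_B by metis
  qed
  moreover have "finite (\<tau> ` A - Inl ` B)"
  proof (rule finite_subset)
    show "\<tau> ` A - Inl ` B \<subseteq> \<tau> ` (A - Inl ` B)" using \<tau>_B by blast
    show "finite (\<tau> ` (A - Inl ` B))" using lab by (simp add: labelling_def A_def)
  qed
  ultimately have "labelling B f X (\<tau> \<circ> p)"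
    using lab conv' unfolding labelling_def by simp
  moreover have "coherent f g k X (\<tau> \<circ> p) q r"
    unfolding coherent_def
  proof (intro ballI)
    fix a b c assume abc: "a \<in> X" "b \<in> X" "c \<in> X"
    have "two_imply_third (p b = f (p a)) (q c = g (q b)) (r a = k (r c))"
      using coh abc by (simp add: coherent_def)
    then show "two_imply_third ((\<tau> \<circ> p) b = f ((\<tau> \<circ> p) a)) (q c = g (q b)) (r a = k (r c))"
      using \<tau>_edge[OF abc(1,2)] no_k[OF abc(3)] no_g[OF abc(3)] abc
      unfolding two_imply_third_def comp_apply by metis
  qed
  ultimately show ?thesis using cfg unfolding config_def by blast
qed

lemma escaping_orbit_inj:
  assumes f: "bij f" and m: "m \<in> B" and esc: "\<forall>n>0. (f ^^ n) m \<notin> B"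
  shows "inj (\<lambda>n. (f ^^ n) m)"
proof -
  have less: "(f ^^ a) m \<noteq> (f ^^ b) m" if "a < b" for a b
  proof
    assume "(f ^^ a) m = (f ^^ b) m"
    then have "(f ^^ a) m = (f ^^ a) ((f ^^ (b - a)) m)"
      using that funpow_add[of a "b - a" f] by simp
    then have "m = (f ^^ (b - a)) m" using f by (metis bij_fn bij_is_inj inj_eq)
    then show False using esc m that by (metis zero_less_diff)
  qed
  show ?thesis
  proof (rule injI)
    fix a b assume "(f ^^ a) m = (f ^^ b) m"
    then show "a = b" using less by (metis linorder_neqE_nat)
  qed
qed

text \<open>
  The orbit of \<open>m\<close> serves as the main chain: it starts in \<open>B\<close>, never returns, and is assigned
  up to some last point. Before the chain of \<open>x\<close> is spliced behind it, one new vertex goes to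
  the end of the main chain and one to the start of the chain of \<open>x\<close>. The ends where the
  chains meet are then free of the edges that would interfere.
\<close>

lemma make_permanent:
  assumes cfg: "config B f g k X p q r" and f: "f = lift 1 f0" and bij: "bij f0"
    and m: "m \<in> B" and esc: "\<forall>n>0. (f0 ^^ n) m \<notin> B" and x: "x \<in> X"
  shows "\<exists>X' p' q' r'. config B f g k X' p' q' r' \<and> extends X p q r X' p' q' r'
           \<and> p' x \<in> range Inl"
proof (cases "p x")
  case (Inl a)
  then have "p x \<in> range Inl" by simp
  with cfg extends_refl[of X p q r] show ?thesis by (intro exI conjI)
next
  case (Inr ji)
  then obtain j i where px: "p x = Inr (j, i)" by (cases ji) simp
  have lab: "labelling B f X p" using cfg by (simp add: config_def)
  have inj: "(f0 ^^ a) m = (f0 ^^ b) m \<longleftrightarrow> a = b" for a b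
    using escaping_orbit_inj[OF bij m esc] by (auto dest: injD)
  define S where "S = {n. Inl ((f0 ^^ n) m) \<in> p ` X}"
  have "0 \<in> S" using lab m by (auto simp: S_def labelling_def)
  have "finite S"
  proof -
    have "(\<lambda>n. Inl ((f0 ^^ n) m)) ` (S - {0}) \<subseteq> p ` X - Inl ` B"
      using esc by (auto simp: S_def)
    then have "finite ((\<lambda>n. Inl ((f0 ^^ n) m) :: 'a label) ` (S - {0}))"
      using lab finite_subset unfolding labelling_def by blast
    moreover have "inj_on (\<lambda>n. Inl ((f0 ^^ n) m) :: 'a label) (S - {0})"
      using inj by (auto simp: inj_on_def)
    ultimately show ?thesis using finite_imageD by fastforce
  qed
  \<comment> \<open>The last assigned point of the main chain.\<close>
  define N where "N = Max S"
  have "N \<in> S" using \<open>finite S\<close> \<open>0 \<in> S\<close> by (auto simp: N_def intro: Max_in)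
  have above: "Inl ((f0 ^^ n) m) \<notin> p ` X" if "n > N" for n
  proof
    assume "Inl ((f0 ^^ n) m) \<in> p ` X"
    then have "n \<le> N" using Max_ge[OF \<open>finite S\<close>, of n] by (simp add: S_def N_def)
    then show False using that by simp
  qed
  obtain u where u: "u \<in> X" "p u = Inl ((f0 ^^ N) m)"
    using \<open>N \<in> S\<close> unfolding S_def by (metis (mono_tags, lifting) imageE mem_Collect_eq)
  have fu: "f (p u) = Inl ((f0 ^^ Suc N) m)" by (simp add: f u)
  then have "f (p u) \<notin> p ` X" using above[of "Suc N"] by simp
  from add_successor[OF cfg u(1) this] obtain w qw rw where w: "w \<notin> X"
    and cfg1: "config B f g k (insert w X) (p(w := f (p u))) (q(w := qw)) (r(w := rw))"
    and ext1: "extends X p q r (insert w X) (p(w := f (p u))) (q(w := qw)) (r(w := rw))"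
    and loop1: "rw \<noteq> k rw"
    and free1: "\<And>y. y \<in> X \<Longrightarrow> rw \<noteq> k (r y) \<and> r y \<noteq> k rw \<and> qw \<noteq> g (q y)"
    by metis
  define X1 p1 q1 r1 where d1: "X1 = insert w X" "p1 = p(w := f (p u))" "q1 = q(w := qw)" "r1 = r(w := rw)"
  note cfg1 = cfg1[folded d1] and ext1 = ext1[folded d1]
  have lab1: "labelling B f X1 p1" using cfg1 by (simp add: config_def)
  have im1: "p1 ` X1 = insert (f (p u)) (p ` X)" using w by (auto simp: d1)
  define I where "I = {i. Inr (j, i) \<in> p1 ` X1}"
  have "i \<in> I" using x px im1 by (auto simp: I_def image_iff) (metis px)
  have "finite I"
  proof -
    have "(\<lambda>i. Inr (j, i)) ` I \<subseteq> p1 ` X1 - Inl ` B" by (auto simp: I_def)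
    then have "finite ((\<lambda>i. Inr (j, i) :: 'a label) ` I)"
      using lab1 finite_subset unfolding labelling_def by blast
    moreover have "inj_on (\<lambda>i. Inr (j, i) :: 'a label) I" by (auto simp: inj_on_def)
    ultimately show ?thesis using finite_imageD by blast
  qed
  \<comment> \<open>The first point of the reserve chain that contains the label of x.\<close>
  define l where "l = Min I"
  have "l \<in> I" using \<open>finite I\<close> \<open>i \<in> I\<close> by (auto simp: l_def intro: Min_in)
  have l_least: "l \<le> i" if "Inr (j, i) \<in> p1 ` X1" for i
    using that \<open>finite I\<close> by (auto simp: l_def I_def)
  have new2: "Inr (j, l - 1) \<notin> p1 ` X1" using l_least[of "l - 1"] by auto
  have "f (Inr (j, l - 1)) \<in> p1 ` X1" using \<open>l \<in> I\<close> by (simp add: f I_def)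
  from add_predecessor[OF cfg1 this new2] obtain w' qw' rw' where w': "w' \<notin> X1"
    and cfg2: "config B f g k (insert w' X1) (p1(w' := Inr (j, l - 1))) (q1(w' := qw')) (r1(w' := rw'))"
    and ext2: "extends X1 p1 q1 r1 (insert w' X1) (p1(w' := Inr (j, l - 1))) (q1(w' := qw')) (r1(w' := rw'))"
    and loop2: "qw' \<noteq> g qw'"
    and free2: "\<And>y. y \<in> X1 \<Longrightarrow> q1 y \<noteq> g qw' \<and> qw' \<noteq> g (q1 y) \<and> r1 y \<noteq> k rw'"
    by metis
  define X2 p2 q2 r2 where d2: "X2 = insert w' X1" "p2 = p1(w' := Inr (j, l - 1))"
    "q2 = q1(w' := qw')" "r2 = r1(w' := rw')"
  note cfg2 = cfg2[folded d2] and ext2 = ext2[folded d2]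
  have im2: "p2 ` X2 = insert (Inr (j, l - 1)) (p1 ` X1)" using w' by (auto simp: d2)
  have ne: "w \<noteq> w'" using w' by (auto simp: d1)
  define \<tau> :: "'a label \<Rightarrow> 'a label" where
    "\<tau> = (\<lambda>s. case s of Inl a \<Rightarrow> Inl a
      | Inr (j', i) \<Rightarrow> if j' = j then Inl ((f0 ^^ nat (i - (l - 1) + 1)) ((f0 ^^ Suc N) m)) else s)"
  have cfg3: "config B f g k X2 (\<tau> \<circ> p2) q2 r2"
    unfolding \<tau>_def
  proof (rule join_chains[OF cfg2 f])
    show "w \<in> X2" "w' \<in> X2" by (simp_all add: d1 d2)
    show "p2 w = Inl ((f0 ^^ Suc N) m)" using ne fu by (simp add: d1 d2)
    show "p2 w' = Inr (j, l - 1)" by (simp add: d2)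
    show "Inl ((f0 ^^ n) ((f0 ^^ Suc N) m)) \<notin> p2 ` X2" if "n > 0" for n
    proof -
      have "(f0 ^^ n) ((f0 ^^ Suc N) m) = (f0 ^^ (n + Suc N)) m"
        using funpow_add[of n "Suc N" f0] by simp
      then show ?thesis unfolding im2 im1 fu using above[of "n + Suc N"] inj[of "n + Suc N" "Suc N"] that by auto
    qed
    show "l - 1 \<le> i" if "Inr (j, i) \<in> p2 ` X2" for i
      using that l_least[of i] unfolding im2 by auto
    show "r2 w \<noteq> k (r2 y)" if y: "y \<in> X2" for y
    proof -
      have "r2 w = rw" using ne by (simp add: d1 d2)
      moreover consider "y = w'" | "y = w" "y \<noteq> w'" | "y \<in> X" "y \<noteq> w" "y \<noteq> w'" using y by (auto simp: d1 d2)
      then have "rw \<noteq> k (r2 y)"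
      proof cases
        case 1
        then show ?thesis using free2[of w] by (simp add: d1 d2)
      next
        case 2
        then show ?thesis using loop1 by (simp add: d1 d2)
      next
        case 3
        then show ?thesis using free1[of y] by (simp add: d1 d2)
      qed
      ultimately show ?thesis by simp
    qed
    show "q2 y \<noteq> g (q2 w')" if "y \<in> X2" for y
      using that loop2 free2[of y] by (cases "y = w'") (simp_all add: d2)
  qed
  have ext3: "extends X2 p2 q2 r2 X2 (\<tau> \<circ> p2) q2 r2"
    by (simp add: extends_def keeps_def \<tau>_def)
  have "x \<noteq> w" "x \<noteq> w'" using x w w' by (auto simp: d1)
  then have "p2 x = Inr (j, i)" using px by (simp add: d1 d2)
  then have "(\<tau> \<circ> p2) x \<in> range Inl" by (simp add: \<tau>_def)
  with cfg3 extends_trans[OF ext1 extends_trans[OF ext2 ext3]] show ?thesis by (intro exI conjI)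
qed

definition settled :: "'v set \<Rightarrow> ('v \<Rightarrow> 'p label) \<Rightarrow> 'v \<Rightarrow> 'p \<Rightarrow> bool" where
  "settled X l x s \<longleftrightarrow> x \<in> X \<and> l x \<in> range Inl \<and> Inl s \<in> l ` X"

lemma settled_keeps:
  assumes "settled X l x s" "X \<subseteq> X'" "keeps X l l'" shows "settled X' l' x s"
proof -
  obtain y a where "x \<in> X" "l x = Inl a" "y \<in> X" "l y = Inl s"
    using assms(1) by (auto simp: settled_def)
  then show ?thesis using assms(2,3) by (force simp: settled_def keeps_def image_iff)
qed

lemma settle:
  assumes cfg: "config B f g k X p q r" and f: "f = lift 1 f0" and bij: "bij f0"
    and m: "m \<in> B" and esc: "\<forall>n>0. (f0 ^^ n) m \<notin> B"
  shows "\<exists>X' p' q' r'. config B f g k X' p' q' r' \<and> extends X p q r X' p' q' r'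
           \<and> settled X' p' x s"
proof -
  obtain X1 p1 q1 r1 where 1: "config B f g k X1 p1 q1 r1" "extends X p q r X1 p1 q1 r1" "x \<in> X1"
  proof (cases "x \<in> X")
    case True
    then show ?thesis by (rule that[OF cfg extends_refl])
  next
    case False
    from add_vertex[OF cfg this] show ?thesis by (elim exE conjE) (rule that, assumption+, simp)
  qed
  obtain X2 p2 q2 r2 where 2: "config B f g k X2 p2 q2 r2" "extends X1 p1 q1 r1 X2 p2 q2 r2" "p2 x \<in> range Inl"
    using make_permanent[OF 1(1) f bij m esc 1(3)] by (elim exE conjE)
  obtain X3 p3 q3 r3 where 3: "config B f g k X3 p3 q3 r3" "extends X2 p2 q2 r2 X3 p3 q3 r3" "Inl s \<in> p3 ` X3"
    using assign_label[OF 2(1), of "Inl s"] by (elim exE conjE)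
  have "x \<in> X2" using 1(3) 2(2) by (auto simp: extends_def)
  then have "settled X3 p3 x s"
    using 2(3) 3(2,3) by (auto simp: settled_def extends_def keeps_def)
  with 3(1) extends_trans[OF 1(2) extends_trans[OF 2(2) 3(2)]] show ?thesis by (intro exI conjI)
qed

text \<open>
  For the third coordinate the free half of the main chain extends along \<open>h\<close>, that is,
  backwards along \<open>k\<close>. This case is reduced to the first by reversal.
\<close>

lemma settle_all:
  assumes cfg: "config B f g k X p q r"
    and fgk: "f = lift 1 f0" "g = lift 1 g0" "k = invf (lift 1 h0)" and bij: "bij f0" "bij g0" "bij h0"
    and esc_f: "a \<in> B" "\<forall>n>0. (f0 ^^ n) a \<notin> B"
    and esc_g: "b \<in> B" "\<forall>n>0. (g0 ^^ n) b \<notin> B"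
    and esc_h: "c \<in> B" "\<forall>n>0. (h0 ^^ n) c \<notin> B"
  shows "\<exists>X' p' q' r'. config B f g k X' p' q' r' \<and> extends X p q r X' p' q' r'
           \<and> settled X' p' x s \<and> settled X' q' x s \<and> settled X' r' x s"
proof -
  have bij': "bij f" "bij g" "bij k"
    using bij fgk by (simp_all add: bij_lift bij_imp_bij_inv)
  have inv_k: "invf k = lift 1 h0" unfolding fgk(3) by (rule inv_inv_eq[OF bij_lift(1)[OF bij(3)]])
  obtain X1 p1 q1 r1 where 1: "config B f g k X1 p1 q1 r1" "extends X p q r X1 p1 q1 r1" "settled X1 p1 x s"
    using settle[OF cfg fgk(1) bij(1) esc_f, where x = x and s = s] by (elim exE conjE)
  obtain X2 q2 r2 p2 where 2: "config B g k f X2 q2 r2 p2" "extends X1 q1 r1 p1 X2 q2 r2 p2" "settled X2 q2 x s"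
    using settle[OF config_rotate[OF 1(1)] fgk(2) bij(2) esc_g, where x = x and s = s] by (elim exE conjE)
  note cfg2 = config_rotate[OF config_rotate[OF 2(1)]] and ext2 = extends_rotate[THEN iffD2, OF 2(2)]
  obtain X3 r3 q3 p3 where 3: "config B (invf k) (invf g) (invf f) X3 r3 q3 p3"
      "extends X2 r2 q2 p2 X3 r3 q3 p3" "settled X3 r3 x s"
    using settle[OF config_rotate[OF config_reverse[OF cfg2]] inv_k bij(3) esc_h, where x = x and s = s] by (elim exE conjE)
  have cfg3: "config B f g k X3 p3 q3 r3"
    using config_rotate[OF config_reverse[OF 3(1)]] bij' by (simp add: inv_inv_eq)
  have ext3: "extends X2 p2 q2 r2 X3 p3 q3 r3" using 3(2) by (simp add: extends_def)
  have sub: "X1 \<subseteq> X2" "X2 \<subseteq> X3" and keep: "keeps X1 p1 p2" "keeps X2 p2 p3" "keeps X2 q2 q3"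
    using ext2 ext3 by (simp_all add: extends_def)
  have "settled X3 p3 x s" by (rule settled_keeps[OF settled_keeps[OF 1(3) sub(1) keep(1)] sub(2) keep(2)])
  moreover have "settled X3 q3 x s" by (rule settled_keeps[OF 2(3) sub(2) keep(3)])
  moreover note 3(3)
  moreover note cfg3 extends_trans[OF 1(2) extends_trans[OF ext2 ext3]]
  ultimately show ?thesis by (intro exI conjI)
qed

section \<open>Passage to the limit\<close>

lemma limit_labelling:
  fixes X :: "nat \<Rightarrow> 'v set" and l :: "nat \<Rightarrow> 'v \<Rightarrow> 'p label"
  assumes mono: "\<And>n. X n \<subseteq> X (Suc n) \<and> keeps (X n) (l n) (l (Suc n))"
    and inj: "\<And>n. inj_on (l n) (X n)"
    and vertex: "\<And>x. \<exists>n. x \<in> X n \<and> l n x \<in> range Inl"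
    and label: "\<And>s. \<exists>n. Inl s \<in> l n ` X n"
  shows "\<exists>\<alpha>. bij \<alpha> \<and> (\<forall>n x s. x \<in> X n \<longrightarrow> l n x = Inl s \<longrightarrow> \<alpha> x = s)
    \<and> (\<forall>x. \<exists>n. \<forall>i\<ge>n. x \<in> X i \<and> l i x = Inl (\<alpha> x))"
proof -
  have later: "X n \<subseteq> X m \<and> keeps (X n) (l n) (l m)" if "n \<le> m" for n m
    using that
  proof (induction m rule: dec_induct)
    case base
    then show ?case by (simp add: keeps_def)
  next
    case (step i)
    then show ?case using mono[of i] unfolding keeps_def by blast
  qed
  have "\<exists>s n. x \<in> X n \<and> l n x = Inl s" for x using vertex[of x] by auto
  then obtain \<alpha> N where \<alpha>: "\<And>x. x \<in> X (N x) \<and> l (N x) x = Inl (\<alpha> x)" by metis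
  have stable: "x \<in> X i \<and> l i x = Inl (\<alpha> x)" if "N x \<le> i" for x i
    using later[OF that] \<alpha>[of x] by (auto simp: keeps_def)
  have limit: "\<alpha> x = s" if "x \<in> X n" "l n x = Inl s" for n x s
    using later[of n "max n (N x)"] stable[of x "max n (N x)"] that by (auto simp: keeps_def)
  have "inj \<alpha>"
  proof (rule injI)
    fix x y assume "\<alpha> x = \<alpha> y"
    then show "x = y"
      using stable[of x "max (N x) (N y)"] stable[of y "max (N x) (N y)"] inj[of "max (N x) (N y)"]
      unfolding inj_on_def by simp
  qed
  moreover have "\<exists>x. s = \<alpha> x" for s
  proof -
    obtain n x where "x \<in> X n" "l n x = Inl s" using label[of s] by (metis imageE)
    then show ?thesis using limit by blast
  qed
  ultimately have "bij \<alpha>" unfolding bij_def surj_def by blast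
  then show ?thesis using limit stable by blast
qed

lemma labelling_initial:
  assumes "bij f" "orbit_convex f B" shows "labelling B (lift 1 f) B Inl"
proof -
  have "lifted (lift 1 f)" using assms(1) by (auto simp: lifted_def)
  moreover have "orbit_convex (lift 1 f) (Inl ` B)"
    using assms(2) by (auto simp: orbit_convex_def)
  ultimately show ?thesis by (simp add: labelling_def)
qed

text \<open>
  Alternately settle all three coordinates of every vertex and of every label. The limits of
  the permanent labels are bijections, and each triangle is already settled at some finite
  stage, where it is coherent.
\<close>

theorem coherent_completion:
  fixes f g h :: "'p::countable \<Rightarrow> 'p"
  assumes bij: "bij f" "bij g" "bij h"
    and conv: "orbit_convex f B" "orbit_convex g B" "orbit_convex h B"
    and inf: "infinite (- B)"
    and esc_f: "a \<in> B" "\<forall>n>0. (f ^^ n) a \<notin> B"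
    and esc_g: "b \<in> B" "\<forall>n>0. (g ^^ n) b \<notin> B"
    and esc_h: "c \<in> B" "\<forall>n>0. (h ^^ n) c \<notin> B"
    and coh: "\<And>a b c. a \<in> B \<Longrightarrow> b \<in> B \<Longrightarrow> c \<in> B \<Longrightarrow> two_imply_third (b = f a) (c = g b) (c = h a)"
  obtains \<alpha> \<beta> \<gamma> where "bij \<alpha>" "bij \<beta>" "bij \<gamma>"
    "\<forall>x\<in>B. \<alpha> x = x" "\<forall>x\<in>B. \<beta> x = x" "\<forall>x\<in>B. \<gamma> x = x"
    "\<And>a b c. \<alpha> b = f (\<alpha> a) \<Longrightarrow> \<beta> c = g (\<beta> b) \<Longrightarrow> \<gamma> c = h (\<gamma> a)"
proof -
  define F G K where FGK: "F = lift 1 f" "G = lift 1 g" "K = invf (lift 1 h)"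
  have K_iff: "s = K t \<longleftrightarrow> t = lift 1 h s" for s t
    using eq_inv_iff[OF bij_lift(1)[OF bij(3)]] by (simp only: FGK)
  have init: "config B F G K B Inl Inl Inl"
    unfolding config_def
  proof (intro conjI inf)
    show "labelling B F B Inl" "labelling B G B Inl"
      unfolding FGK using bij conv by (simp_all add: labelling_initial)
    show "labelling B K B Inl"
      unfolding FGK by (rule labelling_inv[OF labelling_initial[OF bij(3) conv(3)]])
    show "coherent F G K B Inl Inl Inl"
      unfolding coherent_def K_iff using coh by (simp add: FGK)
  qed
  define good :: "'p set \<times> ('p \<Rightarrow> 'p label) \<times> ('p \<Rightarrow> 'p label) \<times> ('p \<Rightarrow> 'p label) \<Rightarrow> bool"
    where "good = (\<lambda>(X, p, q, r). config B F G K X p q r)"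
  \<comment> \<open>One enumeration serves for vertices and labels, as both range over the same type.\<close>
  define step :: "nat \<Rightarrow> 'p set \<times> ('p \<Rightarrow> 'p label) \<times> ('p \<Rightarrow> 'p label) \<times> ('p \<Rightarrow> 'p label) \<Rightarrow> _ \<Rightarrow> bool"
    where "step n = (\<lambda>(X, p, q, r) (X', p', q', r'). extends X p q r X' p' q' r'
      \<and> settled X' p' (from_nat n) (from_nat n) \<and> settled X' q' (from_nat n) (from_nat n)
      \<and> settled X' r' (from_nat n) (from_nat n))" for n
  have "\<exists>S. \<forall>n. (good (S n) \<and> (n = 0 \<longrightarrow> S n = (B, Inl, Inl, Inl))) \<and> step n (S n) (S (Suc n))"
  proof (rule dependent_nat_choice)
    show "\<exists>s. good s \<and> (0 = (0::nat) \<longrightarrow> s = (B, Inl, Inl, Inl))" using init by (simp add: good_def)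
    fix s :: "'p set \<times> ('p \<Rightarrow> 'p label) \<times> ('p \<Rightarrow> 'p label) \<times> ('p \<Rightarrow> 'p label)" and n :: nat
    assume s: "good s \<and> (n = 0 \<longrightarrow> s = (B, Inl, Inl, Inl))"
    obtain X p q r where s_eq: "s = (X, p, q, r)" by (cases s)
    with s have "config B F G K X p q r" by (simp add: good_def)
    from settle_all[OF this FGK bij esc_f esc_g esc_h, where x = "from_nat n" and s = "from_nat n"]
    obtain X' p' q' r' where "good (X', p', q', r')" "step n s (X', p', q', r')"
      unfolding good_def step_def s_eq by (elim exE conjE) simp
    then show "\<exists>s'. (good s' \<and> (Suc n = 0 \<longrightarrow> s' = (B, Inl, Inl, Inl))) \<and> step n s s'"
      by (intro exI[of _ "(X', p', q', r')"]) simp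
  qed
  then obtain S where S: "\<And>n. good (S n)" "S 0 = (B, Inl, Inl, Inl)" "\<And>n. step n (S n) (S (Suc n))"
    by blast
  define X p q r where XS: "X n = fst (S n)" "p n = fst (snd (S n))" "q n = fst (snd (snd (S n)))"
    "r n = snd (snd (snd (S n)))" for n
  have S_eq: "S n = (X n, p n, q n, r n)" for n by (simp add: XS)
  have cfg: "config B F G K (X n) (p n) (q n) (r n)" for n
    using S(1)[of n] by (simp add: S_eq good_def)
  have ext: "extends (X n) (p n) (q n) (r n) (X (Suc n)) (p (Suc n)) (q (Suc n)) (r (Suc n))"
    and set: "settled (X (Suc n)) (p (Suc n)) (from_nat n) (from_nat n)"
      "settled (X (Suc n)) (q (Suc n)) (from_nat n) (from_nat n)"
      "settled (X (Suc n)) (r (Suc n)) (from_nat n) (from_nat n)" for n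
    using S(3)[of n] by (simp_all add: S_eq step_def)
  have zero: "X 0 = B" "p 0 = Inl" "q 0 = Inl" "r 0 = Inl" using S(2) by (simp_all add: XS)
  have inj: "inj_on (p n) (X n)" "inj_on (q n) (X n)" "inj_on (r n) (X n)" for n
    using cfg[of n] by (simp_all add: config_def labelling_def)
  have mono: "X n \<subseteq> X (Suc n) \<and> keeps (X n) (p n) (p (Suc n))"
    "X n \<subseteq> X (Suc n) \<and> keeps (X n) (q n) (q (Suc n))"
    "X n \<subseteq> X (Suc n) \<and> keeps (X n) (r n) (r (Suc n))" for n
    using ext[of n] by (simp_all add: extends_def)
  have total: "(\<exists>n. x \<in> X n \<and> l n x \<in> range Inl) \<and> (\<exists>n. Inl x \<in> l n ` X n)"
    if "\<And>n. settled (X (Suc n)) (l (Suc n)) (from_nat n) (from_nat n)"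
    for x :: 'p and l :: "nat \<Rightarrow> 'p \<Rightarrow> 'p label"
    using that[of "to_nat x"] unfolding settled_def from_nat_to_nat by blast
  obtain \<alpha> where \<alpha>: "bij \<alpha>" "\<forall>n x s. x \<in> X n \<longrightarrow> p n x = Inl s \<longrightarrow> \<alpha> x = s"
    "\<forall>x. \<exists>n. \<forall>i\<ge>n. x \<in> X i \<and> p i x = Inl (\<alpha> x)"
    using limit_labelling[of X p, OF mono(1) inj(1) total[OF set(1), THEN conjunct1] total[OF set(1), THEN conjunct2]]
    by (elim exE conjE)
  obtain \<beta> where \<beta>: "bij \<beta>" "\<forall>n x s. x \<in> X n \<longrightarrow> q n x = Inl s \<longrightarrow> \<beta> x = s"
    "\<forall>x. \<exists>n. \<forall>i\<ge>n. x \<in> X i \<and> q i x = Inl (\<beta> x)"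
    using limit_labelling[of X q, OF mono(2) inj(2) total[OF set(2), THEN conjunct1] total[OF set(2), THEN conjunct2]]
    by (elim exE conjE)
  obtain \<gamma> where \<gamma>: "bij \<gamma>" "\<forall>n x s. x \<in> X n \<longrightarrow> r n x = Inl s \<longrightarrow> \<gamma> x = s"
    "\<forall>x. \<exists>n. \<forall>i\<ge>n. x \<in> X i \<and> r i x = Inl (\<gamma> x)"
    using limit_labelling[of X r, OF mono(3) inj(3) total[OF set(3), THEN conjunct1] total[OF set(3), THEN conjunct2]]
    by (elim exE conjE)
  show ?thesis
  proof (rule that[OF \<alpha>(1) \<beta>(1) \<gamma>(1)])
    show "\<forall>x\<in>B. \<alpha> x = x" "\<forall>x\<in>B. \<beta> x = x" "\<forall>x\<in>B. \<gamma> x = x"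
      using \<alpha>(2)[rule_format, of _ 0] \<beta>(2)[rule_format, of _ 0] \<gamma>(2)[rule_format, of _ 0]
      by (simp_all add: zero)
    fix a b c assume ab: "\<alpha> b = f (\<alpha> a)" and bc: "\<beta> c = g (\<beta> b)"
    have late: "\<exists>n. \<forall>i\<ge>n. P i \<and> Q i" if "\<exists>n. \<forall>i\<ge>n. P i" "\<exists>n. \<forall>i\<ge>n. Q i"
      for P Q :: "nat \<Rightarrow> bool"
      using that by (meson le_cases order_trans)
    obtain n where "\<forall>i\<ge>n. ((a \<in> X i \<and> p i a = Inl (\<alpha> a)) \<and> (a \<in> X i \<and> r i a = Inl (\<gamma> a))) \<and>
        ((b \<in> X i \<and> p i b = Inl (\<alpha> b)) \<and> (b \<in> X i \<and> q i b = Inl (\<beta> b))) \<and>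
        ((c \<in> X i \<and> q i c = Inl (\<beta> c)) \<and> (c \<in> X i \<and> r i c = Inl (\<gamma> c)))"
      using late[OF late[OF \<alpha>(3)[rule_format, of a] \<gamma>(3)[rule_format, of a]] late[OF late[OF \<alpha>(3)[rule_format, of b] \<beta>(3)[rule_format, of b]]
        late[OF \<beta>(3)[rule_format, of c] \<gamma>(3)[rule_format, of c]]]] by blast
    then have n: "a \<in> X n" "b \<in> X n" "c \<in> X n" "p n a = Inl (\<alpha> a)" "p n b = Inl (\<alpha> b)"
      "q n b = Inl (\<beta> b)" "q n c = Inl (\<beta> c)" "r n a = Inl (\<gamma> a)" "r n c = Inl (\<gamma> c)"
      by simp_all
    have "two_imply_third (p n b = F (p n a)) (q n c = G (q n b)) (r n a = K (r n c))"
      using cfg[of n] n(1-3) by (simp add: config_def coherent_def)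
    then show "\<gamma> c = h (\<gamma> a)"
      using n(4-9) ab bc unfolding K_iff two_imply_third_def by (simp add: FGK)
  qed
qed

section \<open>From injections to permutations\<close>

text \<open>
  The point \<open>(d, i)\<close> reaches \<open>s d\<close> after \<open>i + 1\<close> steps. If \<open>s\<close> enumerates the points outside of
  the image of \<open>u\<close>, these backward chains complete \<open>u\<close> to a permutation. Indices outside of \<open>D\<close>
  give fixed points, so that several maps can be completed on one and the same set.
\<close>

definition prolong :: "('a \<Rightarrow> 'a) \<Rightarrow> 'd set \<Rightarrow> ('d \<Rightarrow> 'a) \<Rightarrow> 'a + 'd \<times> nat \<Rightarrow> 'a + 'd \<times> nat" where
  "prolong u D s x = (case x of Inl y \<Rightarrow> Inl (u y)
     | Inr (d, i) \<Rightarrow> if d \<in> D then (case i of 0 \<Rightarrow> Inl (s d) | Suc j \<Rightarrow> Inr (d, j)) else Inr (d, i))"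

lemma prolong_simps [simp]:
  "prolong u D s (Inl y) = Inl (u y)"
  "d \<in> D \<Longrightarrow> prolong u D s (Inr (d, 0)) = Inl (s d)"
  "d \<in> D \<Longrightarrow> prolong u D s (Inr (d, Suc j)) = Inr (d, j)"
  "d \<notin> D \<Longrightarrow> prolong u D s (Inr (d, i)) = Inr (d, i)"
  by (simp_all add: prolong_def)

lemma prolong_funpow_Inl: "(prolong u D s ^^ n) (Inl y) = Inl ((u ^^ n) y)"
  by (induction n) simp_all

lemma bij_prolong:
  assumes u: "inj u" and s: "bij_betw s D (- range u)"
  shows "bij (prolong u D s)"
proof (rule bijI)
  have s_new: "s d \<noteq> u y" if "d \<in> D" for d y using s that by (auto simp: bij_betw_def)
  have s_inj: "s d = s d' \<longleftrightarrow> d = d'" if "d \<in> D" "d' \<in> D" for d d'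
    using s that by (auto simp: bij_betw_def inj_on_def)
  show "inj (prolong u D s)"
  proof (rule injI)
    fix x y assume "prolong u D s x = prolong u D s y"
    then show "x = y" using u s_new s_inj s_new[THEN not_sym]
      by (auto simp: prolong_def inj_eq split: sum.splits nat.splits if_splits)
  qed
  have "y \<in> range (prolong u D s)" for y
  proof (cases y)
    case (Inl z)
    show ?thesis
    proof (cases "z \<in> range u")
      case True
      then obtain y' where "z = u y'" by blast
      then show ?thesis using Inl by (intro image_eqI[of _ _ "Inl y'"]) simp_all
    next
      case False
      then have "z \<in> s ` D" using s by (simp add: bij_betw_def)
      then obtain d where "d \<in> D" "z = s d" by blast
      then show ?thesis using Inl by (intro image_eqI[of _ _ "Inr (d, 0)"]) simp_all
    qed
  next
    case (Inr di)
    obtain d i where "di = (d, i)" by (cases di)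
    then show ?thesis using Inr
      by (intro image_eqI[of _ _ "Inr (d, if d \<in> D then Suc i else i)"]) simp_all
  qed
  then show "surj (prolong u D s)" by blast
qed

lemma orbit_convex_prolong: "orbit_convex (prolong u D s) (range Inr)"
  unfolding orbit_convex_def
proof (intro ballI allI impI)
  fix x and n m :: nat
  assume n: "(prolong u D s ^^ n) x \<in> range Inr" and "m \<le> n"
  then have split: "(prolong u D s ^^ n) x = (prolong u D s ^^ (n - m)) ((prolong u D s ^^ m) x)"
    using funpow_add[of "n - m" m "prolong u D s"] by simp
  show "(prolong u D s ^^ m) x \<in> range Inr"
  proof (cases "(prolong u D s ^^ m) x")
    case (Inl y)
    then show ?thesis using n split by (auto simp: prolong_funpow_Inl)
  qed simp
qed

lemma prolong_escapes:
  assumes "d \<in> D" shows "\<forall>n>0. (prolong u D s ^^ n) (Inr (d, 0)) \<notin> range Inr"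
proof (intro allI impI)
  fix n :: nat assume "n > 0"
  then obtain m where "n = Suc m" by (cases n) auto
  then have "(prolong u D s ^^ n) (Inr (d, 0)) = Inl ((u ^^ m) (s d))"
    using assms by (simp add: funpow_Suc_right prolong_funpow_Inl del: funpow.simps)
  then show "(prolong u D s ^^ n) (Inr (d, 0)) \<notin> range Inr" by auto
qed

text \<open>
  On the added points the three completions already satisfy the required relation: the chains
  over \<open>D1\<close> are moved by the first and third map, those over \<open>D2\<close> by the second and third.
\<close>

lemma prolong_coherent:
  assumes "D1 \<inter> D2 = {}"
    and "a \<in> range Inr" "b \<in> range Inr" "c \<in> range Inr"
  shows "two_imply_third (b = prolong u D1 s a) (c = prolong v D2 t b) (c = prolong w (D1 \<union> D2) z a)"
proof -
  obtain da ia db ib dc ic where "a = Inr (da, ia)" "b = Inr (db, ib)" "c = Inr (dc, ic)"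
    using assms(2-4) by (metis imageE surj_pair)
  then show ?thesis using assms(1) unfolding two_imply_third_def
    by (cases ia; cases ib; cases "da \<in> D1"; cases "da \<in> D2"; cases "db \<in> D1"; cases "db \<in> D2")
       auto
qed

lemma bij_restrict_Inl:
  assumes A: "bij A" and id: "\<forall>y\<in>range Inr. A y = y"
  shows "\<exists>\<alpha>. bij \<alpha> \<and> (\<forall>x. A (Inl x) = Inl (\<alpha> x))"
proof -
  have inj: "A x = A y \<longleftrightarrow> x = y" for x y using A by (simp add: bij_is_inj inj_eq)
  have "\<exists>y. A (Inl x) = Inl y" for x
  proof (cases "A (Inl x)")
    case (Inr z)
    then have "A (Inl x) = A (Inr z)" using id by simp
    then show ?thesis by (simp add: inj)
  qed simp
  then obtain \<alpha> where \<alpha>: "\<And>x. A (Inl x) = Inl (\<alpha> x)" by metis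
  have "inj \<alpha>"
  proof (rule injI)
    fix x y assume "\<alpha> x = \<alpha> y"
    then have "A (Inl x) = A (Inl y)" by (simp add: \<alpha>)
    then show "x = y" by (simp add: inj)
  qed
  moreover have "\<exists>x. y = \<alpha> x" for y
  proof -
    obtain x where x: "A x = Inl y" using A by (metis bij_pointE)
    then show ?thesis using id \<alpha> by (cases x) auto
  qed
  ultimately have "bij \<alpha>" unfolding bij_def surj_def by blast
  then show ?thesis using \<alpha> by blast
qed

text \<open>
  The hypothesis on the defects says that the backward chains of \<open>h\<close> can be indexed by those
  of \<open>f\<close> and \<open>g\<close> together. The completed permutations then admit a coherent labelling that
  is the identity on the added points; it restricts to the original set. The third labelling
  is used to identify the vertices with the domain of \<open>h\<close>.
\<close>

theorem conjugate_product_of_defects: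
  fixes f g h :: "'a::countable \<Rightarrow> 'a"
  assumes inf: "infinite (UNIV :: 'a set)" and inj: "inj f" "inj g" "inj h"
    and f: "\<not> surj f" and g: "\<not> surj g"
    and card: "|- range f| +c |- range g| =o |- range h|"
  obtains \<alpha> \<beta> where "bij \<alpha>" "bij \<beta>" "\<And>x. \<beta> (h x) = g (\<beta> (invf \<alpha> (f (\<alpha> x))))"
proof -
  have "|(- range f) <+> (- range g)| =o |- range h|"
    using card unfolding csum_def Field_card_of .
  then obtain \<phi> where \<phi>: "bij_betw \<phi> ((- range f) <+> (- range g)) (- range h)"
    using card_of_ordIso by blast
  define D1 D2 :: "('a + 'a) set" where D: "D1 = Inl ` (- range f)" "D2 = Inr ` (- range g)"
  have disj: "D1 \<inter> D2 = {}" by (auto simp: D)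
  define F G H where FGH: "F = prolong f D1 projl" "G = prolong g D2 projr" "H = prolong h (D1 \<union> D2) \<phi>"
  have "bij_betw projl D1 (- range f)" "bij_betw projr D2 (- range g)"
    by (auto simp: bij_betw_def inj_on_def D image_iff)
  moreover have "bij_betw \<phi> (D1 \<union> D2) (- range h)" using \<phi> by (simp add: D Plus_def)
  ultimately have bij: "bij F" "bij G" "bij H" unfolding FGH using inj by (simp_all add: bij_prolong)
  obtain d1 d2 where d: "d1 \<in> D1" "d2 \<in> D2" using f g by (auto simp: D)
  then have d3: "d1 \<in> D1 \<union> D2" by simp
  have inf': "infinite (- range (Inr :: _ \<Rightarrow> 'a + ('a + 'a) \<times> nat))"
  proof
    assume "finite (- range (Inr :: _ \<Rightarrow> 'a + ('a + 'a) \<times> nat))"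
    then have "finite (range (Inl :: 'a \<Rightarrow> 'a + ('a + 'a) \<times> nat))" by (rule rev_finite_subset) auto
    then show False using inf by (simp add: finite_image_iff)
  qed
  have conv: "orbit_convex F (range Inr)" "orbit_convex G (range Inr)" "orbit_convex H (range Inr)"
    by (simp_all add: FGH orbit_convex_prolong)
  note completion = coherent_completion[OF bij conv inf'
    rangeI prolong_escapes[OF d(1), of f projl, folded FGH]
    rangeI prolong_escapes[OF d(2), of g projr, folded FGH]
    rangeI prolong_escapes[OF d3, of h \<phi>, folded FGH]
    prolong_coherent[OF disj, of _ _ _ f projl g projr h \<phi>, folded FGH]]
  show ?thesis
  proof (rule completion)
    fix A B C :: "'a + ('a + 'a) \<times> nat \<Rightarrow> 'a + ('a + 'a) \<times> nat"
    assume ABC: "bij A" "bij B" "bij C"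
      "\<forall>x\<in>range Inr. A x = x" "\<forall>x\<in>range Inr. B x = x" "\<forall>x\<in>range Inr. C x = x"
      "\<And>a b c. A b = F (A a) \<Longrightarrow> B c = G (B b) \<Longrightarrow> C c = H (C a)"
    obtain \<alpha> where \<alpha>: "bij \<alpha>" "\<forall>x. A (Inl x) = Inl (\<alpha> x)"
      using bij_restrict_Inl[OF ABC(1,4)] by (elim exE conjE)
    obtain \<beta> where \<beta>: "bij \<beta>" "\<forall>x. B (Inl x) = Inl (\<beta> x)"
      using bij_restrict_Inl[OF ABC(2,5)] by (elim exE conjE)
    obtain \<gamma> where \<gamma>: "bij \<gamma>" "\<forall>x. C (Inl x) = Inl (\<gamma> x)"
      using bij_restrict_Inl[OF ABC(3,6)] by (elim exE conjE)
    have coh: "\<gamma> c = h (\<gamma> a)" if "\<alpha> b = f (\<alpha> a)" "\<beta> c = g (\<beta> b)" for a b c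
      using ABC(7)[of "Inl b" "Inl a" "Inl c"] that by (simp add: \<alpha>(2)[rule_format] \<beta>(2)[rule_format] \<gamma>(2)[rule_format] FGH)
    note surj = \<alpha>(1)[THEN bij_is_surj, THEN surj_f_inv_f] \<beta>(1)[THEN bij_is_surj, THEN surj_f_inv_f]
      \<gamma>(1)[THEN bij_is_surj, THEN surj_f_inv_f]
    have inv_\<gamma>: "invf \<gamma> (\<gamma> x) = x" for x using \<gamma>(1) by (simp add: bij_is_inj)
    have bij_inv: "bij (invf \<gamma>)" using \<gamma>(1) by (rule bij_imp_bij_inv)
    show ?thesis
    proof (rule that)
      show "bij (\<alpha> \<circ> invf \<gamma>)" "bij (\<beta> \<circ> invf \<gamma>)" using \<alpha>(1) \<beta>(1) bij_inv by (simp_all add: bij_comp)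
      fix x
      define a where "a = invf \<gamma> x"
      define b where "b = invf \<alpha> (f (\<alpha> a))"
      define c where "c = invf \<beta> (g (\<beta> b))"
      have "\<gamma> c = h (\<gamma> a)" by (rule coh[of b]) (simp_all add: b_def c_def surj)
      then have "\<gamma> c = h x" by (simp add: a_def surj)
      then have hx: "invf \<gamma> (h x) = c" using inv_\<gamma> by metis
      have "(\<alpha> \<circ> invf \<gamma>) (\<gamma> b) = f ((\<alpha> \<circ> invf \<gamma>) x)"
        by (simp add: inv_\<gamma> a_def[symmetric] b_def surj)
      then have "invf (\<alpha> \<circ> invf \<gamma>) (f ((\<alpha> \<circ> invf \<gamma>) x)) = \<gamma> b"
        using \<open>bij (\<alpha> \<circ> invf \<gamma>)\<close> by (metis bij_inv_eq_iff)
      then show "(\<beta> \<circ> invf \<gamma>) (h x) = g ((\<beta> \<circ> invf \<gamma>) (invf (\<alpha> \<circ> invf \<gamma>) (f ((\<alpha> \<circ> invf \<gamma>) x))))"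
        by (simp add: hx inv_\<gamma> c_def surj)
    qed
  qed
qed

section \<open>Maps on a countable set\<close>

lemma product_of_conjugates_iff:
  assumes a: "a \<in> Sym \<Omega>" and b: "b \<in> Sym \<Omega>"
    and f: "f \<in> carrier (Inj \<Omega>)" and g: "g \<in> carrier (Inj \<Omega>)" and h: "h \<in> carrier (Inj \<Omega>)"
  shows "h = a \<otimes>\<^bsub>Inj \<Omega>\<^esub> f \<otimes>\<^bsub>Inj \<Omega>\<^esub> inv\<^bsub>Inj \<Omega>\<^esub> a \<otimes>\<^bsub>Inj \<Omega>\<^esub> b \<otimes>\<^bsub>Inj \<Omega>\<^esub> g \<otimes>\<^bsub>Inj \<Omega>\<^esub> inv\<^bsub>Inj \<Omega>\<^esub> b
     \<longleftrightarrow> (\<forall>x\<in>\<Omega>. b (h x) = g (b (inv_into \<Omega> a (f (a x)))))"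
proof -
  have bij: "bij_betw a \<Omega> \<Omega>" "bij_betw b \<Omega> \<Omega>" using a b by (simp_all add: Bij_def)
  have a_in: "a x \<in> \<Omega>" "inv_into \<Omega> a x \<in> \<Omega>" and b_in: "b x \<in> \<Omega>" "inv_into \<Omega> b x \<in> \<Omega>" if "x \<in> \<Omega>" for x
    using bij that bij_betwE bij_betw_inv_into by metis+
  have f_in: "f x \<in> \<Omega>" and g_in: "g x \<in> \<Omega>" and h_in: "h x \<in> \<Omega>" if "x \<in> \<Omega>" for x
    using f g h that by (auto simp: Inj_def)
  let ?P = "a \<otimes>\<^bsub>Inj \<Omega>\<^esub> f \<otimes>\<^bsub>Inj \<Omega>\<^esub> inv\<^bsub>Inj \<Omega>\<^esub> a \<otimes>\<^bsub>Inj \<Omega>\<^esub> b \<otimes>\<^bsub>Inj \<Omega>\<^esub> g \<otimes>\<^bsub>Inj \<Omega>\<^esub> inv\<^bsub>Inj \<Omega>\<^esub> b"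
  have P: "?P x = inv_into \<Omega> b (g (b (inv_into \<Omega> a (f (a x)))))" if "x \<in> \<Omega>" for x
    using that by (simp add: inv_Sym[OF a] inv_Sym[OF b]) (simp add: Inj_def compose_def a_in b_in f_in g_in)
  have "?P \<in> extensional \<Omega>" by (simp add: Inj_def)
  moreover have "h \<in> extensional \<Omega>" using h by (auto simp: Inj_def PiE_def)
  ultimately have "h = ?P \<longleftrightarrow> (\<forall>x\<in>\<Omega>. h x = ?P x)" by (metis extensionalityI)
  also have "\<dots> \<longleftrightarrow> (\<forall>x\<in>\<Omega>. b (h x) = g (b (inv_into \<Omega> a (f (a x)))))"
  proof (rule ball_cong[OF refl])
    fix x assume x: "x \<in> \<Omega>"
    let ?y = "g (b (inv_into \<Omega> a (f (a x))))"
    have "?y \<in> \<Omega>" using x by (simp add: a_in b_in f_in g_in)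
    then have "b (inv_into \<Omega> b ?y) = ?y" using bij(2) by (simp add: bij_betw_inv_into_right)
    then show "h x = ?P x \<longleftrightarrow> b (h x) = ?y"
      using P[OF x] h_in[OF x] bij_betw_inv_into_left[OF bij(2), of "h x"] by metis
  qed
  finally show ?thesis .
qed

text \<open>
  With \<open>c\<close> the permutation \<open>b a\<^sup>-\<^sup>1\<close> (right factor first), the permutation \<open>b\<close> carries the
  complement of the image of \<open>h\<close> to that of the image of \<open>g c f\<close>. The latter consists of what
  \<open>g\<close> misses and of the \<open>gc\<close>-image of what \<open>f\<close> misses.
\<close>

lemma defect_add:
  assumes f: "f ` \<Omega> \<subseteq> \<Omega>" "inj_on f \<Omega>" and g: "g ` \<Omega> \<subseteq> \<Omega>" "inj_on g \<Omega>"
    and a: "bij_betw a \<Omega> \<Omega>" and b: "bij_betw b \<Omega> \<Omega>" and h: "h ` \<Omega> \<subseteq> \<Omega>"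
    and eq: "\<forall>x\<in>\<Omega>. b (h x) = g (b (inv_into \<Omega> a (f (a x))))"
  shows "|\<Omega> - f ` \<Omega>| +c |\<Omega> - g ` \<Omega>| =o |\<Omega> - h ` \<Omega>|"
proof -
  define c where "c = b \<circ> inv_into \<Omega> a"
  have c: "bij_betw c \<Omega> \<Omega>" unfolding c_def by (rule bij_betw_trans[OF bij_betw_inv_into[OF a] b])
  have c_im: "c ` \<Omega> = \<Omega>" and c_inj: "inj_on c \<Omega>" using c by (simp_all add: bij_betw_def)
  have "b ` h ` \<Omega> = (\<lambda>x. g (c (f x))) ` a ` \<Omega>"
    using eq by (auto simp: c_def image_image cong: image_cong_simp)
  then have "b ` h ` \<Omega> = (\<lambda>x. g (c (f x))) ` \<Omega>"
    unfolding bij_betw_imp_surj_on[OF a] .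
  then have bh: "b ` h ` \<Omega> = g ` c ` f ` \<Omega>" by (simp add: image_image)
  have inj_gc: "inj_on (\<lambda>x. g (c x)) \<Omega>"
    using comp_inj_on[OF c_inj, of g] g(2) c_im by (simp add: comp_def)
  define \<phi> where "\<phi> = case_sum (\<lambda>x. g (c x)) (\<lambda>y. y)"
  have "bij_betw \<phi> ((\<Omega> - f ` \<Omega>) <+> (\<Omega> - g ` \<Omega>)) (\<Omega> - b ` h ` \<Omega>)"
    unfolding bij_betw_def
  proof
    have in_g: "g (c x) \<in> g ` \<Omega>" if "x \<in> \<Omega>" for x
      using imageI[OF that, of c] unfolding c_im by (rule imageI)
    have inj_gc': "x = y" if "x \<in> \<Omega>" "y \<in> \<Omega>" "g (c x) = g (c y)" for x y
      using inj_onD[OF inj_gc that(3,1,2)] .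
    show "inj_on \<phi> ((\<Omega> - f ` \<Omega>) <+> (\<Omega> - g ` \<Omega>))"
    proof (rule inj_onI)
      fix s t assume "s \<in> (\<Omega> - f ` \<Omega>) <+> (\<Omega> - g ` \<Omega>)" "t \<in> (\<Omega> - f ` \<Omega>) <+> (\<Omega> - g ` \<Omega>)" "\<phi> s = \<phi> t"
      then show "s = t"
        by (auto simp: \<phi>_def dest: inj_gc' in_g)
    qed
    have "\<phi> ` ((\<Omega> - f ` \<Omega>) <+> (\<Omega> - g ` \<Omega>)) = (\<lambda>x. g (c x)) ` (\<Omega> - f ` \<Omega>) \<union> (\<Omega> - g ` \<Omega>)"
      by (simp add: \<phi>_def Plus_def image_Un image_image)
    also have "(\<lambda>x. g (c x)) ` (\<Omega> - f ` \<Omega>) = (\<lambda>x. g (c x)) ` \<Omega> - (\<lambda>x. g (c x)) ` f ` \<Omega>"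
      using inj_on_image_set_diff[OF inj_gc] f(1) by blast
    also have "\<dots> = g ` \<Omega> - b ` h ` \<Omega>"
      unfolding bh image_image[symmetric, of g c] c_im ..
    also have "g ` \<Omega> - b ` h ` \<Omega> \<union> (\<Omega> - g ` \<Omega>) = \<Omega> - b ` h ` \<Omega>"
    proof -
      have "b ` h ` \<Omega> \<subseteq> g ` \<Omega>" unfolding bh using f(1) c_im by blast
      then show ?thesis using g(1) by blast
    qed
    finally show "\<phi> ` ((\<Omega> - f ` \<Omega>) <+> (\<Omega> - g ` \<Omega>)) = \<Omega> - b ` h ` \<Omega>" .
  qed
  moreover have "bij_betw b (\<Omega> - h ` \<Omega>) (\<Omega> - b ` h ` \<Omega>)"
    using b h by (intro bij_betw_imageI)
      (auto simp: bij_betw_def inj_on_image_set_diff[of b \<Omega>] intro: inj_on_subset)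
  ultimately have "bij_betw (inv_into (\<Omega> - h ` \<Omega>) b \<circ> \<phi>) ((\<Omega> - f ` \<Omega>) <+> (\<Omega> - g ` \<Omega>)) (\<Omega> - h ` \<Omega>)"
    by (intro bij_betw_trans[OF _ bij_betw_inv_into])
  then have "|(\<Omega> - f ` \<Omega>) <+> (\<Omega> - g ` \<Omega>)| =o |\<Omega> - h ` \<Omega>|" using card_of_ordIso by blast
  then show ?thesis unfolding csum_def Field_card_of .
qed

theorem corollary10:
  fixes \<Omega> :: "'a set" and f g h :: "'a \<Rightarrow> 'a"
  assumes "countable \<Omega>" and "infinite \<Omega>"
    and "f \<in> carrier (Inj \<Omega>) - Sym \<Omega>"
    and "g \<in> carrier (Inj \<Omega>) - Sym \<Omega>"
    and "h \<in> carrier (Inj \<Omega>) - Sym \<Omega>"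
  shows "(\<exists>a\<in>Sym \<Omega>. \<exists>b\<in>Sym \<Omega>.
            h = a \<otimes>\<^bsub>Inj \<Omega>\<^esub> f \<otimes>\<^bsub>Inj \<Omega>\<^esub> inv\<^bsub>Inj \<Omega>\<^esub> a \<otimes>\<^bsub>Inj \<Omega>\<^esub> b \<otimes>\<^bsub>Inj \<Omega>\<^esub> g \<otimes>\<^bsub>Inj \<Omega>\<^esub> inv\<^bsub>Inj \<Omega>\<^esub> b)
     \<longleftrightarrow> |\<Omega> - f ` \<Omega>| +c |\<Omega> - g ` \<Omega>| =o |\<Omega> - h ` \<Omega>|"
proof -
  have carrier: "f \<in> carrier (Inj \<Omega>)" "g \<in> carrier (Inj \<Omega>)" "h \<in> carrier (Inj \<Omega>)"
    using assms(3-5) by auto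
  note iff = product_of_conjugates_iff[OF _ _ carrier]
  have into: "f ` \<Omega> \<subseteq> \<Omega>" "g ` \<Omega> \<subseteq> \<Omega>" "h ` \<Omega> \<subseteq> \<Omega>"
    and inj: "inj_on f \<Omega>" "inj_on g \<Omega>" "inj_on h \<Omega>"
    using carrier by (auto simp: Inj_def)
  have not_onto: "u ` \<Omega> \<noteq> \<Omega>" if "u \<in> carrier (Inj \<Omega>) - Sym \<Omega>" for u
    using that by (auto simp: Inj_def Bij_def bij_betw_def PiE_def)
  show ?thesis
  proof
    assume "\<exists>a\<in>Sym \<Omega>. \<exists>b\<in>Sym \<Omega>.
            h = a \<otimes>\<^bsub>Inj \<Omega>\<^esub> f \<otimes>\<^bsub>Inj \<Omega>\<^esub> inv\<^bsub>Inj \<Omega>\<^esub> a \<otimes>\<^bsub>Inj \<Omega>\<^esub> b \<otimes>\<^bsub>Inj \<Omega>\<^esub> g \<otimes>\<^bsub>Inj \<Omega>\<^esub> inv\<^bsub>Inj \<Omega>\<^esub> b"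
    then obtain a b where ab: "a \<in> Sym \<Omega>" "b \<in> Sym \<Omega>"
      "\<forall>x\<in>\<Omega>. b (h x) = g (b (inv_into \<Omega> a (f (a x))))"
      using iff by blast
    then show "|\<Omega> - f ` \<Omega>| +c |\<Omega> - g ` \<Omega>| =o |\<Omega> - h ` \<Omega>|"
      using defect_add[OF into(1) inj(1) into(2) inj(2) _ _ into(3) ab(3)] by (simp add: Bij_def)
  next
    assume card: "|\<Omega> - f ` \<Omega>| +c |\<Omega> - g ` \<Omega>| =o |\<Omega> - h ` \<Omega>|"
    \<comment> \<open>Transport to the natural numbers, where maps are total and the type is countable.\<close>
    define e where "e = to_nat_on \<Omega>"
    define d where "d = from_nat_into \<Omega>"
    have d: "bij_betw d UNIV \<Omega>" unfolding d_def using assms(1,2) by (rule bij_betw_from_nat_into)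
    have d_in: "d n \<in> \<Omega>" for n using d by (auto simp: bij_betw_def)
    have de: "d (e x) = x" if "x \<in> \<Omega>" for x
      using that assms(1) by (simp add: d_def e_def)
    have ed: "e (d n) = n" for n using assms(1,2) by (simp add: d_def e_def)
    have e: "bij_betw e \<Omega> UNIV" unfolding e_def using assms(1,2) by (rule to_nat_on_infinite)
    define tr where "tr u n = e (u (d n))" for u n
    have tr: "inj (tr u)" "- range (tr u) = e ` (\<Omega> - u ` \<Omega>)" "|- range (tr u)| =o |\<Omega> - u ` \<Omega>|"
      if u: "u ` \<Omega> \<subseteq> \<Omega>" "inj_on u \<Omega>" for u
    proof -
      have u_in: "u (d n) \<in> \<Omega>" for n using u(1) d_in by blast
      show "inj (tr u)"
      proof (rule injI)
        fix m n assume "tr u m = tr u n"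
        then have "u (d m) = u (d n)" using de[OF u_in] unfolding tr_def by metis
        then have "d m = d n" using u(2) d_in by (meson inj_onD)
        then show "m = n" using ed by metis
      qed
      have "range (tr u) = e ` u ` range d" by (auto simp: tr_def)
      then have "range (tr u) = e ` u ` \<Omega>" using d by (simp add: bij_betw_def)
      moreover have "e ` (\<Omega> - u ` \<Omega>) = UNIV - e ` u ` \<Omega>"
        using e u(1) by (simp add: bij_betw_def inj_on_image_set_diff[of e \<Omega>])
      ultimately show range: "- range (tr u) = e ` (\<Omega> - u ` \<Omega>)" by (simp add: Compl_eq_Diff_UNIV)
      have "bij_betw e (\<Omega> - u ` \<Omega>) (e ` (\<Omega> - u ` \<Omega>))"
        using e by (intro bij_betw_imageI) (auto simp: bij_betw_def inj_on_def)
      then show "|- range (tr u)| =o |\<Omega> - u ` \<Omega>|"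
        unfolding range using card_of_ordIso ordIso_symmetric by blast
    qed
    have not_surj: "\<not> surj (tr u)" if "u \<in> carrier (Inj \<Omega>) - Sym \<Omega>" "u ` \<Omega> \<subseteq> \<Omega>" "inj_on u \<Omega>" for u
      using tr(2)[OF that(2,3)] not_onto[OF that(1)] that(2) by auto
    have "|- range (tr f)| +c |- range (tr g)| =o |\<Omega> - f ` \<Omega>| +c |\<Omega> - g ` \<Omega>|"
      by (rule csum_cong[OF tr(3)[OF into(1) inj(1)] tr(3)[OF into(2) inj(2)]])
    then have card': "|- range (tr f)| +c |- range (tr g)| =o |- range (tr h)|"
      using card tr(3)[OF into(3) inj(3)] by (meson ordIso_symmetric ordIso_transitive)
    obtain \<alpha> \<beta> where \<alpha>: "bij \<alpha>" and \<beta>: "bij \<beta>"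
      and eq: "\<forall>n. \<beta> (tr h n) = tr g (\<beta> (invf \<alpha> (tr f (\<alpha> n))))"
      using conjugate_product_of_defects[OF infinite_UNIV_nat tr(1)[OF into(1) inj(1)]
          tr(1)[OF into(2) inj(2)] tr(1)[OF into(3) inj(3)]
          not_surj[OF assms(3) into(1) inj(1)] not_surj[OF assms(4) into(2) inj(2)] card']
      by blast
    define relabel where "relabel \<pi> = restrict (\<lambda>x. d (\<pi> (e x))) \<Omega>" for \<pi>
    have relabel: "relabel \<pi> \<in> Sym \<Omega>" if "bij \<pi>" for \<pi>
    proof -
      have "bij_betw (d \<circ> (\<pi> \<circ> e)) \<Omega> \<Omega>" using e that d by (metis bij_betw_trans)
      then have "bij_betw (relabel \<pi>) \<Omega> \<Omega>"
        by (rule bij_betw_cong[THEN iffD1, rotated]) (simp add: relabel_def)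
      then show ?thesis by (simp add: Bij_def relabel_def)
    qed
    have relabel_d: "relabel \<pi> (d n) = d (\<pi> n)" for \<pi> n by (simp add: relabel_def d_in ed)
    have inv_relabel: "inv_into \<Omega> (relabel \<alpha>) (d n) = d (invf \<alpha> n)" for n
    proof (rule inv_into_f_eq)
      show "inj_on (relabel \<alpha>) \<Omega>" using relabel[OF \<alpha>] by (simp add: Bij_def bij_betw_def)
      show "relabel \<alpha> (d (invf \<alpha> n)) = d n"
        using \<alpha> by (simp add: relabel_d bij_is_surj surj_f_inv_f)
    qed (rule d_in)
    have act: "u (d n) = d (tr u n)" if "u ` \<Omega> \<subseteq> \<Omega>" for u n
      using that d_in by (simp add: tr_def de image_subset_iff)
    have "\<forall>x\<in>\<Omega>. relabel \<beta> (h x) = g (relabel \<beta> (inv_into \<Omega> (relabel \<alpha>) (f (relabel \<alpha> x))))"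
    proof
      fix x assume "x \<in> \<Omega>"
      then have x: "x = d (e x)" by (simp add: de)
      show "relabel \<beta> (h x) = g (relabel \<beta> (inv_into \<Omega> (relabel \<alpha>) (f (relabel \<alpha> x))))"
        by (subst (1 2) x) (simp add: act[OF into(1)] act[OF into(2)] act[OF into(3)] relabel_d inv_relabel eq)
    qed
    then show "\<exists>a\<in>Sym \<Omega>. \<exists>b\<in>Sym \<Omega>.
            h = a \<otimes>\<^bsub>Inj \<Omega>\<^esub> f \<otimes>\<^bsub>Inj \<Omega>\<^esub> inv\<^bsub>Inj \<Omega>\<^esub> a \<otimes>\<^bsub>Inj \<Omega>\<^esub> b \<otimes>\<^bsub>Inj \<Omega>\<^esub> g \<otimes>\<^bsub>Inj \<Omega>\<^esub> inv\<^bsub>Inj \<Omega>\<^esub> b"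
      using iff[OF relabel[OF \<alpha>] relabel[OF \<beta>]] relabel[OF \<alpha>] relabel[OF \<beta>] by blast
  qed
qed

end
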